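(* Consider the ideal model $(X^{\mathrm{id}},Y^{\mathrm{id}})$ and the extended SO-neighborhood $\mathcal U^{\mathrm{eSO}}(r)$ with radius $r\in(0,1)$ and moment bound $G$ described in the context. Let $D(y)=\mathrm E_{\mathrm{id}}[X^{\mathrm{id}}\mid Y^{\mathrm{id}}=y]-\mathrm E X^{\mathrm{id}}$ and $$f_0(y)=\mathrm E X^{\mathrm{id}}+D(y)\,w_r(D(y)),\quad w_r(z)=\min\{1,\rho/|z|\},\qquad P_0^{Y^{\mathrm{di}}}(dy)=\frac{1-r}{r}\Big(\frac{|D(y)|}{\rho}-1\Big)_+P^{Y^{\mathrm{id}}}(dy),$$ where $\rho>0$ is such that $\int P_0^{Y^{\mathrm{di}}}(dy)=1$. Then, no matter what the bound $G$ is, for any admissible $P_0^{X^{\mathrm{di}}}$ (i.e. with $\mathrm E X^{\mathrm{di}}=\mathrm E X^{\mathrm{id}}$) such that $\mathrm E_{\mathrm{di}}|X^{\mathrm{di}}|^2=G$, the pair $\big(f_0,\,P_0^{Y^{\mathrm{di}}}\otimes P_0^{X^{\mathrm{di}}}\big)$ is a saddle-point of the problem of minimizing over measurable $f$ the quantity $\max_{\mathcal U^{\mathrm{eSO}}(r)}\mathrm E_{\mathrm{re}}|X^{\mathrm{re}}-f(Y^{\mathrm{re}})|^2$. The value of the minimax risk is $$\operatorname{tr}\operatorname{Cov}_{\mathrm{id}}X^{\mathrm{id}}+r\big(G-\mathrm E_{\mathrm{id}}|X^{\mathrm{id}}|^2\big)-(1-r)\,\mathrm E_{\mathrm{id}}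\big[|D(Y^{\mathrm{id}})|^2\,w_r(D(Y^{\mathrm{id}}))\big].$$
   Context: Ideal model: $X^{\mathrm{id}}\sim P^{X^{\mathrm{id}}}$ is an unobservable Euclidean random vector with $\mathrm E|X^{\mathrm{id}}|^2<\infty$; $Y^{\mathrm{id}}$ takes values in an arbitrary measurable space, with $P^{Y^{\mathrm{id}}|X^{\mathrm{id}}=x}(dy)=\pi(y,x)\,\mu(dy)$ for almost all $x$, for some measure $\mu$. The joint ideal law is known. eSO (extended substitutive outlier) model: $(X^{\mathrm{re}},Y^{\mathrm{re}})=(1-U)(X^{\mathrm{id}},Y^{\mathrm{id}})+U(X^{\mathrm{di}},Y^{\mathrm{di}})$ (the ideal pair if $U=0$, the distorting pair if $U=1$), $U\sim\mathrm{Bin}(1,r)$, where $U$ and $(X^{\mathrm{id}},Y^{\mathrm{id}})$ are independent and $U,X^{\mathrm{di}},Y^{\mathrm{di}}$ are mutually independent. The laws $P^{X^{\mathrm{di}}},P^{Y^{\mathrm{di}}}$ are arbitrary except that $\mathrm E_{\mathrm{di}}X^{\mathrm{di}}=\mathrm E_{\mathrm{id}}X^{\mathrm{id}}$ and $\mathrm E_{\mathrm{di}}|X^{\mathrm{di}}|^2\le G$, for a known $G$ with $0<\mathrm E_{\mathrm{id}}|X^{\mathrm{id}}|^2\le G<\infty$. $\partial\mathcal U^{\mathrm{eSO}}(r)$ is the set of all laws $\mathcal L(X^{\mathrm{re}},Y^{\mathrm{re}})$ so obtained, and $\mathcal U^{\mathrm{eSO}}(r)=\bigcup_{0\le s\le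 r}\partial\mathcal U^{\mathrm{eSO}}(s)$. Saddle-point means: letting $P_0\in\partial\mathcal U^{\mathrm{eSO}}(r)$ be the law generated by $P_0^{Y^{\mathrm{di}}}\otimes P_0^{X^{\mathrm{di}}}$, $\mathrm E_P|X^{\mathrm{re}}-f_0(Y^{\mathrm{re}})|^2\le\mathrm E_{P_0}|X^{\mathrm{re}}-f_0(Y^{\mathrm{re}})|^2\le\mathrm E_{P_0}|X^{\mathrm{re}}-f(Y^{\mathrm{re}})|^2$ for all $P\in\mathcal U^{\mathrm{eSO}}(r)$ and all measurable $f$; the minimax risk is the middle value. $(x)_+=\max(x,0)$, $|\cdot|$ is the Euclidean norm, $w_r(0)=1$. *)

theory Defs
  imports "HOL-Probability.Probability"
begin

section \<open>Ideal model\<close>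

text \<open>\<open>K\<close> is a regular conditional distribution of \<open>Y\<close> given \<open>X\<close>.\<close>

definition reg_cond_distr ::
  "'w measure \<Rightarrow> ('w \<Rightarrow> real^'n) \<Rightarrow> 'y measure \<Rightarrow> ('w \<Rightarrow> 'y) \<Rightarrow> (real^'n \<Rightarrow> 'y measure) \<Rightarrow> bool"
  where
  "reg_cond_distr M X N Y K \<longleftrightarrow>
     K \<in> borel \<rightarrow>\<^sub>M prob_algebra N \<and>
     (\<forall>A\<in>sets borel. \<forall>B\<in>sets N.
        emeasure M {\<omega>\<in>space M. X \<omega> \<in> A \<and> Y \<omega> \<in> B} = (\<integral>\<^sup>+x\<in>A. emeasure (K x) B \<partial>distr M borel X))"

text \<open>\<open>P(Y \<in> dy | X = x) = p(y, x) \<mu>(dy)\<close> for almost all \<open>x\<close>. Neither \<open>\<sigma>\<close>-finiteness of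
  \<open>\<mu>\<close> nor joint measurability of \<open>p\<close> is required.\<close>

definition has_cond_density ::
  "'w measure \<Rightarrow> ('w \<Rightarrow> real^'n) \<Rightarrow> 'y measure \<Rightarrow> ('w \<Rightarrow> 'y) \<Rightarrow> 'y measure \<Rightarrow> ('y \<Rightarrow> real^'n \<Rightarrow> ennreal) \<Rightarrow> bool"
  where
  "has_cond_density M X N Y \<mu> p \<longleftrightarrow>
     sets \<mu> = sets N \<and>
     (\<exists>K. reg_cond_distr M X N Y K \<and>
       (AE x in distr M borel X.
          (\<lambda>y. p y x) \<in> borel_measurable N \<and> K x = density \<mu> (\<lambda>y. p y x)))"

text \<open>\<open>m\<close> is a version of \<open>y \<mapsto> E[X | Y = y]\<close>: a measurable function such that \<open>m (Y \<omega>)\<close>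
  is the conditional expectation of \<open>X\<close> given the \<open>\<sigma>\<close>-algebra generated by \<open>Y\<close>.
  The library's conditional expectation is real-valued, hence the components.\<close>

definition cond_mean_version ::
  "'w measure \<Rightarrow> ('w \<Rightarrow> real^'n) \<Rightarrow> 'y measure \<Rightarrow> ('w \<Rightarrow> 'y) \<Rightarrow> ('y \<Rightarrow> real^'n) \<Rightarrow> bool"
  where
  "cond_mean_version M X N Y m \<longleftrightarrow>
     m \<in> borel_measurable N \<and>
     (\<forall>i. AE \<omega> in M.
        m (Y \<omega>) $ i = real_cond_exp M (vimage_algebra (space M) Y N) (\<lambda>\<omega>. X \<omega> $ i) \<omega>)"

definition cov_matrix :: "'w measure \<Rightarrow> ('w \<Rightarrow> real^'n) \<Rightarrow> real^'n^'n"
  where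
  "cov_matrix M X =
     (\<chi> i j. \<integral>\<omega>. (X \<omega> - (\<integral>\<omega>. X \<omega> \<partial>M)) $ i * (X \<omega> - (\<integral>\<omega>. X \<omega> \<partial>M)) $ j \<partial>M)"


section \<open>Extended substitutive outliers\<close>

text \<open>Mutual independence of two and of three random variables with values in different types
  (the library's \<open>indep_var\<close> and \<open>indep_vars\<close> need a common value type).\<close>

definition indep_var2 ::
  "'w measure \<Rightarrow> 'a measure \<Rightarrow> ('w \<Rightarrow> 'a) \<Rightarrow> 'b measure \<Rightarrow> ('w \<Rightarrow> 'b) \<Rightarrow> bool"
  where
  "indep_var2 M A U B V \<longleftrightarrow>
     U \<in> M \<rightarrow>\<^sub>M A \<and> V \<in> M \<rightarrow>\<^sub>M B \<and>
     prob_space.indep_set M {U -` E \<inter> space M | E. E \<in> sets A} {V -` E \<inter> space M | E. E \<in> sets B}"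

definition indep_var3 ::
  "'w measure \<Rightarrow> 'a measure \<Rightarrow> ('w \<Rightarrow> 'a) \<Rightarrow> 'b measure \<Rightarrow> ('w \<Rightarrow> 'b) \<Rightarrow> 'c measure \<Rightarrow> ('w \<Rightarrow> 'c) \<Rightarrow> bool"
  where
  "indep_var3 M A U B V C W \<longleftrightarrow>
     U \<in> M \<rightarrow>\<^sub>M A \<and> V \<in> M \<rightarrow>\<^sub>M B \<and> W \<in> M \<rightarrow>\<^sub>M C \<and>
     prob_space.indep_sets M
       (\<lambda>i::nat. [{U -` E \<inter> space M | E. E \<in> sets A},
                  {V -` E \<inter> space M | E. E \<in> sets B},
                  {W -` E \<inter> space M | E. E \<in> sets C}] ! i) {..<3}"

text \<open>No assumption is made on the dependence between the ideal and the distorting pair.\<close>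

definition eSO_model ::
  "'y measure \<Rightarrow> ((real^'n) \<times> 'y) measure \<Rightarrow> real \<Rightarrow> 'w measure \<Rightarrow> ('w \<Rightarrow> nat) \<Rightarrow>
   ('w \<Rightarrow> real^'n) \<Rightarrow> ('w \<Rightarrow> 'y) \<Rightarrow> ('w \<Rightarrow> real^'n) \<Rightarrow> ('w \<Rightarrow> 'y) \<Rightarrow> bool"
  where
  "eSO_model N Pid s M U Xid Yid Xdi Ydi \<longleftrightarrow>
     prob_space M \<and>
     Xid \<in> M \<rightarrow>\<^sub>M borel \<and> Yid \<in> M \<rightarrow>\<^sub>M N \<and>
     distr M (borel \<Otimes>\<^sub>M N) (\<lambda>\<omega>. (Xid \<omega>, Yid \<omega>)) = Pid \<and>
     distr M (count_space UNIV) U = measure_pmf (binomial_pmf 1 s) \<and>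
     indep_var2 M (count_space UNIV) U (borel \<Otimes>\<^sub>M N) (\<lambda>\<omega>. (Xid \<omega>, Yid \<omega>)) \<and>
     indep_var3 M (count_space UNIV) U borel Xdi N Ydi"

definition eSO_obs ::
  "('w \<Rightarrow> nat) \<Rightarrow> ('w \<Rightarrow> real^'n) \<Rightarrow> ('w \<Rightarrow> 'y) \<Rightarrow> ('w \<Rightarrow> real^'n) \<Rightarrow> ('w \<Rightarrow> 'y) \<Rightarrow> 'w \<Rightarrow> (real^'n) \<times> 'y"
  where
  "eSO_obs U Xid Yid Xdi Ydi \<omega> = (if U \<omega> = 0 then (Xid \<omega>, Yid \<omega>) else (Xdi \<omega>, Ydi \<omega>))"

text \<open>All laws of \<open>(X\<^sup>r\<^sup>e, Y\<^sup>r\<^sup>e)\<close> obtained from \<open>U \<sim> Bin(1, s)\<close>, \<open>X\<^sup>d\<^sup>i \<sim> QX\<close> and \<open>Y\<^sup>d\<^sup>i \<sim> QY\<close>.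
  One cannot quantify over sample spaces of arbitrary type here; the sample space consists of
  tuples \<open>(u, (x, y), (x', y'))\<close>, which is no restriction by lemma \<open>eSO_laws_any_space\<close> below.\<close>

definition eSO_laws ::
  "'y measure \<Rightarrow> ((real^'n) \<times> 'y) measure \<Rightarrow> real \<Rightarrow> (real^'n) measure \<Rightarrow> 'y measure \<Rightarrow>
   ((real^'n) \<times> 'y) measure set"
  where
  "eSO_laws N Pid s QX QY =
     {distr M (borel \<Otimes>\<^sub>M N) (eSO_obs U Xid Yid Xdi Ydi) |
        (M :: (nat \<times> ((real^'n) \<times> 'y) \<times> ((real^'n) \<times> 'y)) measure) U Xid Yid Xdi Ydi.
        eSO_model N Pid s M U Xid Yid Xdi Ydi \<and>
        distr M borel Xdi = QX \<and> distr M N Ydi = QY}"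

text \<open>Admissible laws of \<open>X\<^sup>d\<^sup>i\<close>, where \<open>a\<close> is the mean of \<open>X\<^sup>i\<^sup>d\<close>.\<close>

definition eSO_admissible :: "real^'n \<Rightarrow> real \<Rightarrow> (real^'n) measure \<Rightarrow> bool"
  where
  "eSO_admissible a G Q \<longleftrightarrow>
     prob_space Q \<and> sets Q = sets borel \<and> integrable Q (\<lambda>x. (norm x)\<^sup>2) \<and>
     (\<integral>x. x \<partial>Q) = a \<and> (\<integral>x. (norm x)\<^sup>2 \<partial>Q) \<le> G"

definition eSO_boundary ::
  "'y measure \<Rightarrow> ((real^'n) \<times> 'y) measure \<Rightarrow> real \<Rightarrow> real \<Rightarrow> ((real^'n) \<times> 'y) measure set"
  where
  "eSO_boundary N Pid G s =
     (\<Union>QX\<in>{QX. eSO_admissible (\<integral>z. fst z \<partial>Pid) G QX}.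
      \<Union>QY\<in>{QY. prob_space QY \<and> sets QY = sets N}. eSO_laws N Pid s QX QY)"

definition eSO_nbhd ::
  "'y measure \<Rightarrow> ((real^'n) \<times> 'y) measure \<Rightarrow> real \<Rightarrow> real \<Rightarrow> ((real^'n) \<times> 'y) measure set"
  where
  "eSO_nbhd N Pid G r = (\<Union>s\<in>{0..r}. eSO_boundary N Pid G s)"


section \<open>Risk and saddle-points\<close>

text \<open>Mean squared error; \<open>\<infinity>\<close> if the error is not square integrable.\<close>

definition mse :: "((real^'n) \<times> 'y) measure \<Rightarrow> ('y \<Rightarrow> real^'n) \<Rightarrow> ennreal"
  where "mse P f = (\<integral>\<^sup>+z. ennreal ((norm (fst z - f (snd z)))\<^sup>2) \<partial>P)"

definition eSO_saddle_point ::
  "'y measure \<Rightarrow> ((real^'n) \<times> 'y) measure \<Rightarrow> real \<Rightarrow> real \<Rightarrow>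
   ('y \<Rightarrow> real^'n) \<Rightarrow> ((real^'n) \<times> 'y) measure \<Rightarrow> bool"
  where
  "eSO_saddle_point N Pid G r f0 P0 \<longleftrightarrow>
     f0 \<in> borel_measurable N \<and> P0 \<in> eSO_boundary N Pid G r \<and>
     (\<forall>P\<in>eSO_nbhd N Pid G r. mse P f0 \<le> mse P0 f0) \<and>
     (\<forall>f\<in>borel_measurable N. mse P0 f0 \<le> mse P0 f)"

definition eSO_minimax_risk ::
  "'y measure \<Rightarrow> ((real^'n) \<times> 'y) measure \<Rightarrow> real \<Rightarrow> real \<Rightarrow> ennreal"
  where
  "eSO_minimax_risk N Pid G r =
     (INF f\<in>borel_measurable N. SUP P\<in>eSO_nbhd N Pid G r. mse P f)"

definition clip_weight :: "real \<Rightarrow> real^'n \<Rightarrow> real"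
  where "clip_weight \<rho> z = (if z = 0 then 1 else min 1 (\<rho> / norm z))"

text \<open>The measure \<open>P\<^sub>0\<close> for \<open>Y\<^sup>d\<^sup>i\<close>, with \<open>PY\<close> the law of \<open>Y\<^sup>i\<^sup>d\<close>; \<open>\<rho>\<close> is to be chosen so that
  its total mass is 1.\<close>

definition least_fav_Y :: "real \<Rightarrow> real \<Rightarrow> ('y \<Rightarrow> real^'n) \<Rightarrow> 'y measure \<Rightarrow> 'y measure"
  where
  "least_fav_Y r \<rho> D PY =
     density PY (\<lambda>y. ennreal ((1 - r) / r * max (norm (D y) / \<rho> - 1) 0))"


section \<open>Independence of the choice of the sample space\<close>

lemma indep_var2_distr:
  assumes "prob_space M" and T: "T \<in> M \<rightarrow>\<^sub>M M'"
    and U: "U \<in> M' \<rightarrow>\<^sub>M A" and V: "V \<in> M' \<rightarrow>\<^sub>M B"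
    and ind: "indep_var2 M A (\<lambda>\<omega>. U (T \<omega>)) B (\<lambda>\<omega>. V (T \<omega>))"
  shows "indep_var2 (distr M M' T) A U B V"
proof -
  interpret M: prob_space M by fact
  let ?D = "distr M M' T"
  interpret D: prob_space ?D using T by (rule M.prob_space_distr)
  have eq: "T -` (Z -` E \<inter> space M') \<inter> space M = (\<lambda>\<omega>. Z (T \<omega>)) -` E \<inter> space M" for Z :: "_ \<Rightarrow> 'z" and E
    using measurable_space[OF T] by auto
  have "D.prob ((U -` E \<inter> space M') \<inter> (V -` F \<inter> space M'))
      = D.prob (U -` E \<inter> space M') * D.prob (V -` F \<inter> space M')"
    if EF: "E \<in> sets A" "F \<in> sets B" for E F
  proof -
    have ms: "U -` E \<inter> space M' \<in> sets M'" "V -` F \<inter> space M' \<in> sets M'"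
      using measurable_sets[OF U EF(1)] measurable_sets[OF V EF(2)] by auto
    have *: "T -` ((U -` E \<inter> space M') \<inter> (V -` F \<inter> space M')) \<inter> space M =
        ((\<lambda>\<omega>. U (T \<omega>)) -` E \<inter> space M) \<inter> ((\<lambda>\<omega>. V (T \<omega>)) -` F \<inter> space M)"
      using measurable_space[OF T] by auto
    have "M.prob (((\<lambda>\<omega>. U (T \<omega>)) -` E \<inter> space M) \<inter> ((\<lambda>\<omega>. V (T \<omega>)) -` F \<inter> space M)) =
        M.prob ((\<lambda>\<omega>. U (T \<omega>)) -` E \<inter> space M) * M.prob ((\<lambda>\<omega>. V (T \<omega>)) -` F \<inter> space M)"
      using ind EF unfolding indep_var2_def M.indep_sets2_eq by blast
    then show ?thesis
      using T ms by (simp add: measure_distr sets.Int eq * del: vimage_Int)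
  qed
  then show ?thesis
    using U V measurable_sets[OF U] measurable_sets[OF V]
    unfolding indep_var2_def D.indep_sets2_eq by auto
qed

lemma indep_var3_distr:
  assumes "prob_space M" and T: "T \<in> M \<rightarrow>\<^sub>M M'"
    and U: "U \<in> M' \<rightarrow>\<^sub>M A" and V: "V \<in> M' \<rightarrow>\<^sub>M B" and W: "W \<in> M' \<rightarrow>\<^sub>M C"
    and ind: "indep_var3 M A (\<lambda>\<omega>. U (T \<omega>)) B (\<lambda>\<omega>. V (T \<omega>)) C (\<lambda>\<omega>. W (T \<omega>))"
  shows "indep_var3 (distr M M' T) A U B V C W"
proof -
  interpret M: prob_space M by fact
  let ?D = "distr M M' T"
  interpret D: prob_space ?D using T by (rule M.prob_space_distr)
  let ?F = "\<lambda>i::nat. [{U -` E \<inter> space M' | E. E \<in> sets A}, {V -` E \<inter> space M' | E. E \<in> sets B},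
     {W -` E \<inter> space M' | E. E \<in> sets C}] ! i"
  let ?G = "\<lambda>i::nat. [{(\<lambda>\<omega>. U (T \<omega>)) -` E \<inter> space M | E. E \<in> sets A},
     {(\<lambda>\<omega>. V (T \<omega>)) -` E \<inter> space M | E. E \<in> sets B},
     {(\<lambda>\<omega>. W (T \<omega>)) -` E \<inter> space M | E. E \<in> sets C}] ! i"
  have three: "{..<3} = {0, 1, 2::nat}" by auto
  have pull: "T -` S \<inter> space M \<in> ?G i" if "i \<in> {..<3}" "S \<in> ?F i" for i S
  proof -
    have eq: "T -` (Z -` E \<inter> space M') \<inter> space M = (\<lambda>\<omega>. Z (T \<omega>)) -` E \<inter> space M" for Z :: "_ \<Rightarrow> 'z" and E
      using measurable_space[OF T] by auto
    have "i = 0 \<or> i = 1 \<or> i = 2" using that(1) by auto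
    then show ?thesis using that(2) eq by fastforce
  qed
  have ev: "?F i \<subseteq> D.events" if "i \<in> {..<3}" for i
  proof -
    have "i = 0 \<or> i = 1 \<or> i = 2" using that by auto
    then show ?thesis
      using measurable_sets[OF U] measurable_sets[OF V] measurable_sets[OF W] by auto
  qed
  have sp: "space ?D \<in> ?F i" if "i \<in> {..<3}" for i
  proof -
    have "space M' = Z -` space S \<inter> space M'" if "Z \<in> M' \<rightarrow>\<^sub>M S" for Z and S :: "'z measure"
      using measurable_space[OF that] by auto
    from this[OF U] this[OF V] this[OF W]
    have "space M' \<in> {U -` E \<inter> space M' | E. E \<in> sets A}"
      "space M' \<in> {V -` E \<inter> space M' | E. E \<in> sets B}"
      "space M' \<in> {W -` E \<inter> space M' | E. E \<in> sets C}" by blast+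
    moreover have "i = 0 \<or> i = 1 \<or> i = 2" using that by auto
    ultimately show ?thesis by (elim disjE) (simp_all del: mem_Collect_eq)
  qed
  have G: "M.indep_sets ?G {..<3}" using ind by (simp add: indep_var3_def)
  have "D.indep_sets ?F {..<3}"
  proof (subst D.indep_sets_finite)
    show "\<forall>S\<in>Pi {..<3} ?F. D.prob (\<Inter>j\<in>{..<3}. S j) = (\<Prod>j\<in>{..<3}. D.prob (S j))"
    proof
      fix S assume S: "S \<in> Pi {..<3} ?F"
      have Sev: "S j \<in> sets M'" if "j \<in> {..<3}" for j using S ev that by (auto simp: Pi_iff)
      have int: "(\<Inter>j\<in>{..<3}. S j) \<in> sets M'"
        using Sev by (intro sets.finite_INT) (auto simp: three)
      have "D.prob (\<Inter>j\<in>{..<3}. S j) = M.prob (T -` (\<Inter>j\<in>{..<3}. S j) \<inter> space M)"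
        using T int by (simp add: measure_distr)
      also have "T -` (\<Inter>j\<in>{..<3}. S j) \<inter> space M = (\<Inter>j\<in>{..<3}. T -` S j \<inter> space M)"
        by (auto simp: three)
      also have "M.prob \<dots> = (\<Prod>j\<in>{..<3}. M.prob (T -` S j \<inter> space M))"
      proof (rule M.indep_setsD[OF G])
        show "\<forall>j\<in>{..<3}. T -` S j \<inter> space M \<in> ?G j"
          using S by (intro ballI pull) (blast dest: Pi_mem)+
      qed (simp_all add: three)
      also have "\<dots> = (\<Prod>j\<in>{..<3}. D.prob (S j))"
        using T Sev by (intro prod.cong) (simp_all add: measure_distr)
      finally show "D.prob (\<Inter>j\<in>{..<3}. S j) = (\<Prod>j\<in>{..<3}. D.prob (S j))" .
    qed
  qed (use ev sp in \<open>auto simp: three\<close>)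
  then show ?thesis using U V W by (simp add: indep_var3_def)
qed

lemma eSO_laws_any_space:
  fixes M :: "'w measure"
  assumes model: "eSO_model N Pid s M U Xid Yid Xdi Ydi"
  shows "distr M (borel \<Otimes>\<^sub>M N) (eSO_obs U Xid Yid Xdi Ydi)
    \<in> eSO_laws N Pid s (distr M borel Xdi) (distr M N Ydi)"
proof -
  interpret M: prob_space M using model by (simp add: eSO_model_def)
  have [measurable]: "U \<in> M \<rightarrow>\<^sub>M count_space UNIV" "Xid \<in> M \<rightarrow>\<^sub>M borel" "Yid \<in> M \<rightarrow>\<^sub>M N"
    "Xdi \<in> M \<rightarrow>\<^sub>M borel" "Ydi \<in> M \<rightarrow>\<^sub>M N"
    using model by (auto simp: eSO_model_def indep_var3_def)
  let ?R = "count_space UNIV \<Otimes>\<^sub>M ((borel \<Otimes>\<^sub>M N) \<Otimes>\<^sub>M (borel \<Otimes>\<^sub>M N))"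
  let ?T = "\<lambda>\<omega>. (U \<omega>, (Xid \<omega>, Yid \<omega>), (Xdi \<omega>, Ydi \<omega>))"
  let ?D = "distr M ?R ?T"
  let ?U = "fst" and ?Xi = "\<lambda>t. fst (fst (snd t))" and ?Yi = "\<lambda>t. snd (fst (snd t))"
    and ?Xd = "\<lambda>t. fst (snd (snd t))" and ?Yd = "\<lambda>t. snd (snd (snd t))"
  have T[measurable]: "?T \<in> M \<rightarrow>\<^sub>M ?R" by measurable
  interpret D: prob_space ?D using T by (rule M.prob_space_distr)
  have ind2: "indep_var2 ?D (count_space UNIV) ?U (borel \<Otimes>\<^sub>M N) (\<lambda>t. (?Xi t, ?Yi t))"
    using model by (intro indep_var2_distr[OF M.prob_space_axioms T]) (auto simp: eSO_model_def)
  have ind3: "indep_var3 ?D (count_space UNIV) ?U borel ?Xd N ?Yd"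
    using model by (intro indep_var3_distr[OF M.prob_space_axioms T]) (auto simp: eSO_model_def)
  have "eSO_model N Pid s ?D ?U ?Xi ?Yi ?Xd ?Yd"
    using model ind2 ind3 D.prob_space_axioms
    by (simp add: eSO_model_def distr_distr comp_def)
  moreover have "distr ?D (borel \<Otimes>\<^sub>M N) (eSO_obs ?U ?Xi ?Yi ?Xd ?Yd)
      = distr M (borel \<Otimes>\<^sub>M N) (eSO_obs U Xid Yid Xdi Ydi)"
  proof -
    have "eSO_obs ?U ?Xi ?Yi ?Xd ?Yd \<in> ?R \<rightarrow>\<^sub>M borel \<Otimes>\<^sub>M N"
      unfolding eSO_obs_def[abs_def] by measurable
    then show ?thesis by (subst distr_distr) (auto simp: eSO_obs_def comp_def intro!: distr_cong)
  qed
  moreover have "distr ?D borel ?Xd = distr M borel Xdi" "distr ?D N ?Yd = distr M N Ydi"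
    by (simp_all add: distr_distr comp_def)
  ultimately show ?thesis unfolding eSO_laws_def mem_Collect_eq
    by (intro exI[of _ ?D] exI[of _ ?U] exI[of _ ?Xi] exI[of _ ?Yi] exI[of _ ?Xd] exI[of _ ?Yd] conjI)
      simp_all
qed

end

theory Submission
  imports Defs
begin

text \<open>A law in the neighbourhood is a mixture \<open>(1 - s) P\<^sup>i\<^sup>d + s (Q\<^sub>X \<Otimes> Q\<^sub>Y)\<close>
  (\<open>eSO_laws_nn_integral\<close>), so its risk is the mixture of two risks, and both are explicit. Let
  \<open>a\<close> be the mean of \<open>X\<^sup>i\<^sup>d\<close>, write \<open>g = f - a\<close>, and let \<open>R\<close> be the ideal Bayes risk. Then the ideal risk of \<open>f\<close> is
  \<open>R + E |D - g|\<^sup>2\<close>, by Pythagoras (\<open>cond_mean_pythagoras\<close>). The risk under the contamination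
  is \<open>E |X\<^sup>d\<^sup>i|\<^sup>2 - |a|\<^sup>2 + \<integral> |g|\<^sup>2 dQ\<^sub>Y\<close>, because \<open>X\<^sup>d\<^sup>i\<close> has mean \<open>a\<close> and is
  independent of \<open>Y\<^sup>d\<^sup>i\<close> (\<open>mse_pair_measure\<close>).

  Nature's side: the estimator \<open>f\<^sub>0\<close> has \<open>|g| \<le> \<rho>\<close>, so its risk under a contamination is at
  most \<open>G - |a|\<^sup>2 + \<rho>\<^sup>2\<close>. This bound is attained when \<open>E |X\<^sup>d\<^sup>i|\<^sup>2 = G\<close> and \<open>Q\<^sub>Y\<close>
  lives where \<open>|D| > \<rho>\<close>, as the least favourable law does (\<open>least_fav_Y_clipped_sq\<close>). It is not
  below the ideal risk of \<open>f\<^sub>0\<close>, which is at most the total variance of \<open>X\<^sup>i\<^sup>d\<close>; hence the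
  maximal radius \<open>s = r\<close> is worst.

  The statistician's side: with \<open>h = (|D| / \<rho> - 1)\<^sub>+\<close>, the density of the least favourable
  law merges the two parts of the risk into a constant plus
  \<open>(1 - r) E (|D - g|\<^sup>2 + h |g|\<^sup>2)\<close> (\<open>nn_integral_least_fav_Y\<close>). The integrand is minimised
  pointwise by \<open>g = D / (1 + h)\<close>, which is the clipped \<open>D\<close> (\<open>clip_bayes_optimal\<close>). The
  minimal integrand is \<open>|D|\<^sup>2 (1 - w)\<close> (\<open>clip_bayes_value\<close>), and this gives the value of the
  minimax risk.

  All risks are kept in the extended nonnegative reals, which avoids integrability conditions on the
  competing estimators.\<close>

section \<open>Clipping\<close>

text \<open>The weight is the reciprocal of \<open>max 1 (|z| / \<rho>)\<close>. This ties the clipping to the density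
  \<open>h = (|z| / \<rho> - 1)\<^sub>+\<close> of the least favourable contamination and makes the clipped
  estimator a Bayes estimator.\<close>

lemma clip_weight_eq:
  assumes "0 < \<rho>"
  shows "clip_weight \<rho> z * (1 + max (norm z / \<rho> - 1) 0) = 1" and "0 < clip_weight \<rho> z" "clip_weight \<rho> z \<le> 1"
  using assms by (auto simp: clip_weight_def min_def max_def field_simps)

lemma borel_measurable_clip_weight [measurable]: "clip_weight \<rho> \<in> borel_measurable borel"
  unfolding clip_weight_def[abs_def] by measurable

lemma norm_clip_le:
  assumes "0 < \<rho>"
  shows "norm (clip_weight \<rho> z *\<^sub>R z) \<le> \<rho>"
  using assms by (auto simp: clip_weight_def min_def field_simps)

lemma norm_clip_eq:
  assumes "0 < \<rho>" "\<rho> < norm z"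
  shows "norm (clip_weight \<rho> z *\<^sub>R z) = \<rho>"
  using assms by (auto simp: clip_weight_def min_def field_simps)

lemma clip_bayes_value:
  fixes z :: "real^'n"
  assumes "0 < \<rho>"
  defines "h \<equiv> max (norm z / \<rho> - 1) 0" and "w \<equiv> clip_weight \<rho> z"
  shows "(norm (z - w *\<^sub>R z))\<^sup>2 + h * (norm (w *\<^sub>R z))\<^sup>2 = (norm z)\<^sup>2 * (1 - w)"
proof -
  have *: "w * (1 + h) = 1" "0 < w" "w \<le> 1" using clip_weight_eq[OF assms(1), of z] by (auto simp: assms)
  have e: "z - w *\<^sub>R z = (1 - w) *\<^sub>R z" by (simp add: algebra_simps)
  have "(norm (z - w *\<^sub>R z))\<^sup>2 + h * (norm (w *\<^sub>R z))\<^sup>2 = (norm z)\<^sup>2 * ((1 - w)\<^sup>2 + w * (w * (1 + h)) - w\<^sup>2)"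
    unfolding e by (simp add: power_mult_distrib) (simp add: algebra_simps power2_eq_square)
  also have "\<dots> = (norm z)\<^sup>2 * (1 - w)"
    unfolding *(1) by (simp add: algebra_simps power2_eq_square)
  finally show ?thesis .
qed

text \<open>At an observation \<open>y\<close> with \<open>z = D y\<close>, an estimate \<open>a + g\<close> costs \<open>|z - g|\<^sup>2\<close> under
  the ideal law and \<open>|g|\<^sup>2\<close>, with relative weight \<open>h\<close>, under the contamination.
  Completing the square, the cost exceeds its value at \<open>g = w z\<close> by \<open>|g - w z|\<^sup>2 / w\<close>,
  since \<open>1 + h = 1 / w\<close>.\<close>

lemma clip_bayes_optimal:
  fixes z g :: "real^'n"
  assumes "0 < \<rho>"
  defines "h \<equiv> max (norm z / \<rho> - 1) 0" and "w \<equiv> clip_weight \<rho> z"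
  shows "(norm (z - w *\<^sub>R z))\<^sup>2 + h * (norm (w *\<^sub>R z))\<^sup>2 \<le> (norm (z - g))\<^sup>2 + h * (norm g)\<^sup>2"
proof -
  have *: "w * (1 + h) = 1" "0 < w" using clip_weight_eq[OF assms(1), of z] by (auto simp: assms)
  have h: "h = 1 / w - 1" using * by (simp add: field_simps)
  have "0 \<le> (norm (g - w *\<^sub>R z))\<^sup>2 / w" using * by simp
  also have "\<dots> = (norm (z - g))\<^sup>2 + h * (norm g)\<^sup>2 - (norm z)\<^sup>2 * (1 - w)"
    unfolding h power2_norm_eq_inner using *(2)
    by (simp add: inner_diff inner_commute field_simps power2_eq_square)
  finally show ?thesis using clip_bayes_value[OF assms(1), of z] by (simp add: assms)
qed

section \<open>Conditional means and square integrability\<close>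

lemma integrable_mult_L2:
  fixes u v :: "'w \<Rightarrow> real"
  assumes [measurable]: "u \<in> borel_measurable M" "v \<in> borel_measurable M"
    and "integrable M (\<lambda>x. (u x)\<^sup>2)" "integrable M (\<lambda>x. (v x)\<^sup>2)"
  shows "integrable M (\<lambda>x. u x * v x)"
proof (rule Bochner_Integration.integrable_bound)
  show "integrable M (\<lambda>x. (u x)\<^sup>2 + (v x)\<^sup>2)" using assms by simp
  have "\<bar>b * c\<bar> \<le> b\<^sup>2 + c\<^sup>2" for b c :: real
  proof -
    have "2 * \<bar>b\<bar> * \<bar>c\<bar> \<le> b\<^sup>2 + c\<^sup>2" using sum_squares_bound[of "\<bar>b\<bar>" "\<bar>c\<bar>"] by simp
    moreover have "0 \<le> \<bar>b * c\<bar>" by simp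
    ultimately show ?thesis unfolding abs_mult by linarith
  qed
  then show "AE x in M. norm (u x * v x) \<le> norm ((u x)\<^sup>2 + (v x)\<^sup>2)" by (auto intro!: AE_I2)
qed measurable

lemma borel_measurable_component [measurable]: "(\<lambda>x::real^'n. x $ i) \<in> borel_measurable borel"
  by (intro borel_measurable_continuous_onI continuous_intros)

lemma integrable_component_sq:
  fixes u :: "'w \<Rightarrow> real^'n"
  assumes [measurable]: "u \<in> borel_measurable M" and u2: "integrable M (\<lambda>x. (norm (u x))\<^sup>2)"
  shows "integrable M (\<lambda>x. (u x $ i)\<^sup>2)"
proof (rule Bochner_Integration.integrable_bound[OF u2])
  have "(v $ i)\<^sup>2 \<le> (norm v)\<^sup>2" for v :: "real^'n"
    using power_mono[OF component_le_norm_cart[of v i] abs_ge_zero, of 2] by simp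
  then show "AE x in M. norm ((u x $ i)\<^sup>2) \<le> norm ((norm (u x))\<^sup>2)" by simp
qed measurable

text \<open>Jensen's inequality keeps the conditional mean in \<open>L\<^sup>2\<close>, so that it can be tested
  against every square integrable function of \<open>Y\<close>: componentwise, the residual
  \<open>X - m(Y)\<close> is orthogonal to all of them.\<close>

lemma (in prob_space) cond_mean_L2:
  fixes X :: "'a \<Rightarrow> real^'n"
  assumes [measurable]: "X \<in> M \<rightarrow>\<^sub>M borel" and Y[measurable]: "Y \<in> M \<rightarrow>\<^sub>M N"
    and X2: "integrable M (\<lambda>\<omega>. (norm (X \<omega>))\<^sup>2)" and m: "cond_mean_version M X N Y m"
  shows "integrable M (\<lambda>\<omega>. (m (Y \<omega>) $ i)\<^sup>2)"
    and "\<lbrakk>k \<in> borel_measurable N; integrable M (\<lambda>\<omega>. (k (Y \<omega>))\<^sup>2)\<rbrakk> \<Longrightarrow>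
         (\<integral>\<omega>. k (Y \<omega>) * (m (Y \<omega>) $ i) \<partial>M) = (\<integral>\<omega>. k (Y \<omega>) * (X \<omega> $ i) \<partial>M)"
proof -
  let ?F = "vimage_algebra (space M) Y N"
  have m_meas[measurable]: "m \<in> borel_measurable N"
    and m_AE: "AE \<omega> in M. real_cond_exp M ?F (\<lambda>\<omega>. X \<omega> $ i) \<omega> = m (Y \<omega>) $ i"
    using m by (auto simp: cond_mean_version_def eq_commute)
  have sub: "subalgebra M ?F"
    using measurable_space[OF Y] by (auto simp: subalgebra_def sets_vimage_algebra2 Pi_iff)
  interpret F: finite_measure_subalgebra M ?F by unfold_locales (fact sub)
  have YF: "Y \<in> ?F \<rightarrow>\<^sub>M N"
    using measurable_space[OF Y] by (intro measurable_vimage_algebra1) auto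
  have [measurable]: "(\<lambda>\<omega>. X \<omega> $ i) \<in> borel_measurable M" by measurable
  have [measurable]: "(\<lambda>\<omega>. m (Y \<omega>) $ i) \<in> borel_measurable M" by measurable
  have Xi2: "integrable M (\<lambda>\<omega>. (X \<omega> $ i)\<^sup>2)" by (rule integrable_component_sq[OF _ X2]) measurable
  have Xi: "integrable M (\<lambda>\<omega>. X \<omega> $ i)"
    using integrable_mult_L2[of "\<lambda>_. 1" M "\<lambda>\<omega>. X \<omega> $ i"] Xi2 by simp
  have "integrable M (\<lambda>\<omega>. (real_cond_exp M ?F (\<lambda>\<omega>. X \<omega> $ i) \<omega>)\<^sup>2)"
    using Xi Xi2 by (intro F.integrable_convex_cond_exp[where I = UNIV]) (auto intro: convex_power2)
  then show "integrable M (\<lambda>\<omega>. (m (Y \<omega>) $ i)\<^sup>2)"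
    by (rule integrable_cong_AE_imp) (use m_AE in auto)
  assume [measurable]: "k \<in> borel_measurable N" and k2: "integrable M (\<lambda>\<omega>. (k (Y \<omega>))\<^sup>2)"
  have kF: "(\<lambda>\<omega>. k (Y \<omega>)) \<in> borel_measurable ?F" using YF by measurable
  have "(\<integral>\<omega>. k (Y \<omega>) * (m (Y \<omega>) $ i) \<partial>M) = (\<integral>\<omega>. k (Y \<omega>) * real_cond_exp M ?F (\<lambda>\<omega>. X \<omega> $ i) \<omega> \<partial>M)"
    using m_AE by (intro integral_cong_AE) auto
  also have "\<dots> = (\<integral>\<omega>. k (Y \<omega>) * (X \<omega> $ i) \<partial>M)"
    by (intro F.real_cond_exp_intg(2) kF integrable_mult_L2 k2 Xi2) measurable
  finally show "(\<integral>\<omega>. k (Y \<omega>) * (m (Y \<omega>) $ i) \<partial>M) = (\<integral>\<omega>. k (Y \<omega>) * (X \<omega> $ i) \<partial>M)" .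
qed

lemma integrable_sq_norm_diff:
  fixes u v :: "'w \<Rightarrow> real^'n"
  assumes [measurable]: "u \<in> borel_measurable M" "v \<in> borel_measurable M"
    and "integrable M (\<lambda>x. (norm (u x))\<^sup>2)" "integrable M (\<lambda>x. (norm (v x))\<^sup>2)"
  shows "integrable M (\<lambda>x. (norm (u x - v x))\<^sup>2)"
proof (rule Bochner_Integration.integrable_bound)
  show "integrable M (\<lambda>x. 2 * (norm (u x))\<^sup>2 + 2 * (norm (v x))\<^sup>2)" using assms by simp
  have "(norm (b - c))\<^sup>2 \<le> 2 * (norm b)\<^sup>2 + 2 * (norm c)\<^sup>2" for b c :: "real^'n"
    using inner_ge_zero[of "b + c"]
    unfolding power2_norm_eq_inner inner_add inner_diff by (simp add: inner_commute)
  then show "AE x in M. norm ((norm (u x - v x))\<^sup>2) \<le> norm (2 * (norm (u x))\<^sup>2 + 2 * (norm (v x))\<^sup>2)"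
    by (auto intro!: AE_I2)
qed measurable

lemma (in prob_space) cond_mean_residual_L2:
  fixes X :: "'a \<Rightarrow> real^'n"
  assumes [measurable]: "X \<in> M \<rightarrow>\<^sub>M borel" "Y \<in> M \<rightarrow>\<^sub>M N"
    and X2: "integrable M (\<lambda>\<omega>. (norm (X \<omega>))\<^sup>2)" and m: "cond_mean_version M X N Y m"
  shows "integrable M (\<lambda>\<omega>. (norm (X \<omega> - m (Y \<omega>)))\<^sup>2)"
proof -
  have [measurable]: "m \<in> borel_measurable N" using m by (simp add: cond_mean_version_def)
  have sq: "(norm (v::real^'n))\<^sup>2 = (\<Sum>i\<in>UNIV. (v $ i)\<^sup>2)" for v
    by (simp add: norm_vec_def L2_set_def sum_nonneg)
  have "integrable M (\<lambda>\<omega>. \<Sum>i\<in>UNIV. (m (Y \<omega>) $ i)\<^sup>2)" using cond_mean_L2(1)[OF assms] by auto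
  then have "integrable M (\<lambda>\<omega>. (norm (m (Y \<omega>)))\<^sup>2)" unfolding sq .
  then show ?thesis by (intro integrable_sq_norm_diff X2) measurable
qed

text \<open>The mixed term vanishes by orthogonality when \<open>m(Y) - f(Y)\<close> is square integrable.
  Otherwise both sides are infinite, because \<open>X - m(Y)\<close> is square integrable. The
  extended-valued form thus covers the estimators of infinite risk as well.\<close>

lemma (in prob_space) cond_mean_pythagoras:
  fixes X :: "'a \<Rightarrow> real^'n"
  assumes [measurable]: "X \<in> M \<rightarrow>\<^sub>M borel" and Y[measurable]: "Y \<in> M \<rightarrow>\<^sub>M N"
    and X2: "integrable M (\<lambda>\<omega>. (norm (X \<omega>))\<^sup>2)" and m: "cond_mean_version M X N Y m"
    and [measurable]: "f \<in> borel_measurable N"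
  shows "(\<integral>\<^sup>+\<omega>. ennreal ((norm (X \<omega> - f (Y \<omega>)))\<^sup>2) \<partial>M) =
    (\<integral>\<^sup>+\<omega>. ennreal ((norm (X \<omega> - m (Y \<omega>)))\<^sup>2) \<partial>M) + (\<integral>\<^sup>+\<omega>. ennreal ((norm (m (Y \<omega>) - f (Y \<omega>)))\<^sup>2) \<partial>M)"
proof -
  note L2 = cond_mean_L2[OF assms(1-4)]
  have [measurable]: "m \<in> borel_measurable N" using m by (simp add: cond_mean_version_def)
  note Z2 = cond_mean_residual_L2[OF assms(1-4)]
  let ?k = "\<lambda>\<omega>. m (Y \<omega>) - f (Y \<omega>)" and ?Z = "\<lambda>\<omega>. X \<omega> - m (Y \<omega>)"
  show "(\<integral>\<^sup>+\<omega>. ennreal ((norm (X \<omega> - f (Y \<omega>)))\<^sup>2) \<partial>M) =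
    (\<integral>\<^sup>+\<omega>. ennreal ((norm (?Z \<omega>))\<^sup>2) \<partial>M) + (\<integral>\<^sup>+\<omega>. ennreal ((norm (?k \<omega>))\<^sup>2) \<partial>M)"
  proof (cases "integrable M (\<lambda>\<omega>. (norm (?k \<omega>))\<^sup>2)")
    case k2: True
    have ki2: "integrable M (\<lambda>\<omega>. (?k \<omega> $ i)\<^sup>2)" for i by (rule integrable_component_sq[OF _ k2]) measurable
    have kX: "integrable M (\<lambda>\<omega>. ?k \<omega> $ i * X \<omega> $ i)" for i
      by (rule integrable_mult_L2[OF _ _ ki2 integrable_component_sq[OF _ X2]]) measurable
    have km: "integrable M (\<lambda>\<omega>. ?k \<omega> $ i * m (Y \<omega>) $ i)" for i
      by (rule integrable_mult_L2[OF _ _ ki2 L2(1)]) measurable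
    have orth: "(\<integral>\<omega>. ?k \<omega> $ i * m (Y \<omega>) $ i \<partial>M) = (\<integral>\<omega>. ?k \<omega> $ i * X \<omega> $ i \<partial>M)" for i
      using L2(2)[where k = "\<lambda>y. (m y - f y) $ i" and i = i] ki2[of i] by simp
    have inner: "?k \<omega> \<bullet> ?Z \<omega> = (\<Sum>i\<in>UNIV. ?k \<omega> $ i * X \<omega> $ i - ?k \<omega> $ i * m (Y \<omega>) $ i)" for \<omega>
      by (simp add: inner_vec_def right_diff_distrib)
    have kZ: "integrable M (\<lambda>\<omega>. ?k \<omega> \<bullet> ?Z \<omega>)" unfolding inner using kX km by auto
    have kZ0: "(\<integral>\<omega>. ?k \<omega> \<bullet> ?Z \<omega> \<partial>M) = 0"
      unfolding inner using kX km orth by (subst Bochner_Integration.integral_sum) (auto simp: Bochner_Integration.integral_diff)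
    have expand: "(norm (X \<omega> - f (Y \<omega>)))\<^sup>2 = (norm (?Z \<omega>))\<^sup>2 + (norm (?k \<omega>))\<^sup>2 + 2 * (?k \<omega> \<bullet> ?Z \<omega>)" for \<omega>
      by (simp add: power2_norm_eq_inner inner_diff inner_commute)
    have "(\<integral>\<^sup>+\<omega>. ennreal ((norm (X \<omega> - f (Y \<omega>)))\<^sup>2) \<partial>M) = ennreal (\<integral>\<omega>. (norm (X \<omega> - f (Y \<omega>)))\<^sup>2 \<partial>M)"
    proof (rule nn_integral_eq_integral)
      show "integrable M (\<lambda>\<omega>. (norm (X \<omega> - f (Y \<omega>)))\<^sup>2)" unfolding expand using Z2 k2 kZ by simp
    qed simp
    also have "(\<integral>\<omega>. (norm (X \<omega> - f (Y \<omega>)))\<^sup>2 \<partial>M) = (\<integral>\<omega>. (norm (?Z \<omega>))\<^sup>2 \<partial>M) + (\<integral>\<omega>. (norm (?k \<omega>))\<^sup>2 \<partial>M)"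
      unfolding expand using Z2 k2 kZ kZ0 by simp
    finally show ?thesis
      using nn_integral_eq_integral[OF Z2] nn_integral_eq_integral[OF k2] by simp
  next
    case False
    then have inf: "(\<integral>\<^sup>+\<omega>. ennreal ((norm (?k \<omega>))\<^sup>2) \<partial>M) = \<infinity>"
      by (simp add: integrable_iff_bounded less_top[symmetric])
    have "(\<integral>\<^sup>+\<omega>. ennreal ((norm (X \<omega> - f (Y \<omega>)))\<^sup>2) \<partial>M) = \<infinity>"
    proof (rule ccontr)
      assume "\<not> ?thesis"
      then have "integrable M (\<lambda>\<omega>. (norm (X \<omega> - f (Y \<omega>)))\<^sup>2)"
        by (simp add: integrable_iff_bounded less_top[symmetric])
      then have "integrable M (\<lambda>\<omega>. (norm ((X \<omega> - f (Y \<omega>)) - ?Z \<omega>))\<^sup>2)"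
        by (intro integrable_sq_norm_diff[of "\<lambda>\<omega>. X \<omega> - f (Y \<omega>)" M ?Z] Z2) measurable
      with False show False by simp
    qed
    with inf show ?thesis by simp
  qed
qed

section \<open>Risk under the contamination\<close>

text \<open>This is where the constraint on the mean of the contamination enters: a law with mean
  \<open>a\<close> affects the risk of an estimate \<open>c\<close> only through its second moment, in a summand
  that is independent of \<open>c\<close>.\<close>

lemma second_moment_about_point:
  fixes Q :: "(real^'n) measure"
  assumes "prob_space Q" and [measurable_cong]: "sets Q = sets borel"
    and Q2: "integrable Q (\<lambda>x. (norm x)\<^sup>2)" and mean: "(\<integral>x. x \<partial>Q) = a"
  shows "(\<integral>\<^sup>+x. ennreal ((norm (x - c))\<^sup>2) \<partial>Q) = ennreal ((\<integral>x. (norm x)\<^sup>2 \<partial>Q) - (norm a)\<^sup>2) + ennreal ((norm (c - a))\<^sup>2)"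
    and "(norm a)\<^sup>2 \<le> (\<integral>x. (norm x)\<^sup>2 \<partial>Q)"
proof -
  interpret prob_space Q by fact
  have Q1: "integrable Q (\<lambda>x. x)"
  proof (rule Bochner_Integration.integrable_bound)
    show "integrable Q (\<lambda>x. 1 + (norm x)\<^sup>2)" using Q2 by simp
    have "t \<le> 1 + t\<^sup>2" for t :: real
    proof -
      have "2 * t \<le> t\<^sup>2 + 1" using sum_squares_bound[of t 1] by simp
      then show ?thesis using zero_le_power2[of t] by linarith
    qed
    then show "AE x in Q. norm x \<le> norm (1 + (norm x)\<^sup>2)" by (auto intro!: AE_I2)
  qed measurable
  have in1: "integrable Q (\<lambda>x. x \<bullet> c)" for c using Q1 by simp
  have in0: "(\<integral>x. x \<bullet> c \<partial>Q) = a \<bullet> c" for c using Q1 mean by simp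
  have expand: "(norm (x - c))\<^sup>2 = (norm x)\<^sup>2 + (norm c)\<^sup>2 - 2 * (x \<bullet> c)" for x c :: "real^'n"
    by (simp add: power2_norm_eq_inner inner_diff inner_commute)
  have int: "integrable Q (\<lambda>x. (norm (x - c))\<^sup>2)" for c
    unfolding expand using Q2 in1 by auto
  have val: "(\<integral>x. (norm (x - c))\<^sup>2 \<partial>Q) = (\<integral>x. (norm x)\<^sup>2 \<partial>Q) - (norm a)\<^sup>2 + (norm (c - a))\<^sup>2" for c
    unfolding expand using Q2 in1[of c] by (simp add: in0 prob_space) (simp add: power2_norm_eq_inner inner_commute)
  have "0 \<le> (\<integral>x. (norm (x - a))\<^sup>2 \<partial>Q)" by simp
  then show *: "(norm a)\<^sup>2 \<le> (\<integral>x. (norm x)\<^sup>2 \<partial>Q)" unfolding val by simp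
  show "(\<integral>\<^sup>+x. ennreal ((norm (x - c))\<^sup>2) \<partial>Q) = ennreal ((\<integral>x. (norm x)\<^sup>2 \<partial>Q) - (norm a)\<^sup>2) + ennreal ((norm (c - a))\<^sup>2)"
    using * by (simp add: nn_integral_eq_integral[OF int] val)
qed

lemma (in prob_space) second_moment_about_mean:
  fixes X :: "'a \<Rightarrow> real^'n"
  assumes [measurable]: "X \<in> M \<rightarrow>\<^sub>M borel" and X2: "integrable M (\<lambda>\<omega>. (norm (X \<omega>))\<^sup>2)"
    and a: "a = (\<integral>\<omega>. X \<omega> \<partial>M)"
  shows "(norm a)\<^sup>2 \<le> (\<integral>\<omega>. (norm (X \<omega>))\<^sup>2 \<partial>M)"
    and "(\<integral>\<^sup>+\<omega>. ennreal ((norm (X \<omega> - a))\<^sup>2) \<partial>M) = ennreal ((\<integral>\<omega>. (norm (X \<omega>))\<^sup>2 \<partial>M) - (norm a)\<^sup>2)"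
    and "trace (cov_matrix M X) = (\<integral>\<omega>. (norm (X \<omega>))\<^sup>2 \<partial>M) - (norm a)\<^sup>2"
proof -
  let ?Q = "distr M borel X"
  have Q: "prob_space ?Q" "sets ?Q = sets borel" "integrable ?Q (\<lambda>x. (norm x)\<^sup>2)" "(\<integral>x. x \<partial>?Q) = a"
    by (simp_all add: prob_space_distr integrable_distr_eq X2 integral_distr a)
  have QS: "(\<integral>x. (norm x)\<^sup>2 \<partial>?Q) = (\<integral>\<omega>. (norm (X \<omega>))\<^sup>2 \<partial>M)" by (simp add: integral_distr)
  show le: "(norm a)\<^sup>2 \<le> (\<integral>\<omega>. (norm (X \<omega>))\<^sup>2 \<partial>M)"
    using second_moment_about_point(2)[OF Q] unfolding QS .
  show nn: "(\<integral>\<^sup>+\<omega>. ennreal ((norm (X \<omega> - a))\<^sup>2) \<partial>M) = ennreal ((\<integral>\<omega>. (norm (X \<omega>))\<^sup>2 \<partial>M) - (norm a)\<^sup>2)"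
    using second_moment_about_point(1)[OF Q, of a] unfolding QS by (simp add: nn_integral_distr)
  have int: "integrable M (\<lambda>\<omega>. (norm (X \<omega> - a))\<^sup>2)"
    by (rule integrableI_nn_integral_finite[OF _ _ nn]) (use le in simp_all)
  have "trace (cov_matrix M X) = (\<Sum>i\<in>UNIV. \<integral>\<omega>. ((X \<omega> - a) $ i)\<^sup>2 \<partial>M)"
    by (simp add: trace_def cov_matrix_def a power2_eq_square)
  also have "\<dots> = (\<integral>\<omega>. (\<Sum>i\<in>UNIV. ((X \<omega> - a) $ i)\<^sup>2) \<partial>M)"
    by (intro Bochner_Integration.integral_sum[symmetric] integrable_component_sq[OF _ int]) measurable
  also have "\<dots> = (\<integral>\<omega>. (norm (X \<omega> - a))\<^sup>2 \<partial>M)"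
    by (simp add: norm_vec_def L2_set_def sum_nonneg)
  also have "\<dots> = (\<integral>\<omega>. (norm (X \<omega>))\<^sup>2 \<partial>M) - (norm a)\<^sup>2"
    by (rule nn_integral_eq_integral[OF int, unfolded nn, THEN ennreal_inj[THEN iffD1, rotated 2], symmetric])
      (use le in auto)
  finally show "trace (cov_matrix M X) = (\<integral>\<omega>. (norm (X \<omega>))\<^sup>2 \<partial>M) - (norm a)\<^sup>2" .
qed

text \<open>Under the contamination \<open>Y\<close> carries no information on \<open>X\<close>, and every deviation of the
  estimator from the mean \<open>a\<close> is pure loss.\<close>

lemma mse_pair_measure:
  fixes QX :: "(real^'n) measure"
  assumes X: "prob_space QX" "sets QX = sets borel"
    "integrable QX (\<lambda>x. (norm x)\<^sup>2)" "(\<integral>x. x \<partial>QX) = a"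
    and Y: "prob_space QY" "sets QY = sets N" and [measurable]: "f \<in> borel_measurable N"
  shows "mse (QX \<Otimes>\<^sub>M QY) f = ennreal ((\<integral>x. (norm x)\<^sup>2 \<partial>QX) - (norm a)\<^sup>2) + (\<integral>\<^sup>+y. ennreal ((norm (f y - a))\<^sup>2) \<partial>QY)"
proof -
  interpret QX: prob_space QX by fact
  interpret QY: prob_space QY by fact
  interpret pair_sigma_finite QX QY ..
  note [measurable_cong] = X(2) Y(2)
  have "mse (QX \<Otimes>\<^sub>M QY) f = (\<integral>\<^sup>+y. (\<integral>\<^sup>+x. ennreal ((norm (x - f y))\<^sup>2) \<partial>QX) \<partial>QY)"
    unfolding mse_def by (subst nn_integral_snd[symmetric]) (simp_all add: case_prod_beta)
  also have "\<dots> = (\<integral>\<^sup>+y. ennreal ((\<integral>x. (norm x)\<^sup>2 \<partial>QX) - (norm a)\<^sup>2) + ennreal ((norm (f y - a))\<^sup>2) \<partial>QY)"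
    by (simp add: second_moment_about_point(1)[OF X])
  also have "\<dots> = ennreal ((\<integral>x. (norm x)\<^sup>2 \<partial>QX) - (norm a)\<^sup>2) + (\<integral>\<^sup>+y. ennreal ((norm (f y - a))\<^sup>2) \<partial>QY)"
    by (subst nn_integral_add) (simp_all add: QY.emeasure_space_1)
  finally show ?thesis .
qed

section \<open>Laws in the contamination model\<close>

text \<open>Given \<open>U\<close>, just one of the ideal and the distorting pair is observed, and each of them
  is independent of \<open>U\<close>; so the law of the observation is a mixture, however the two pairs
  depend on each other.\<close>

lemma eSO_laws_nn_integral:
  fixes QX :: "(real^'n) measure"
  assumes P: "P \<in> eSO_laws N Pid s QX QY" and s: "0 \<le> s" "s \<le> 1"
    and h: "h \<in> borel_measurable (borel \<Otimes>\<^sub>M N)"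
  shows "sets P = sets (borel \<Otimes>\<^sub>M N)"
    and "(\<integral>\<^sup>+z. h z \<partial>P) = ennreal (1 - s) * (\<integral>\<^sup>+z. h z \<partial>Pid) + ennreal s * (\<integral>\<^sup>+z. h z \<partial>(QX \<Otimes>\<^sub>M QY))"
proof -
  obtain M :: "(nat \<times> ((real^'n) \<times> 'a) \<times> ((real^'n) \<times> 'a)) measure" and U Xid Yid Xdi Ydi
    where P: "P = distr M (borel \<Otimes>\<^sub>M N) (eSO_obs U Xid Yid Xdi Ydi)"
      and mod: "eSO_model N Pid s M U Xid Yid Xdi Ydi"
      and QX: "distr M borel Xdi = QX" and QY: "distr M N Ydi = QY"
    using P by (auto simp: eSO_laws_def)
  show "sets P = sets (borel \<Otimes>\<^sub>M N)" by (simp add: P)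
  interpret M: prob_space M using mod by (simp add: eSO_model_def)
  have U[measurable]: "U \<in> M \<rightarrow>\<^sub>M count_space UNIV" and [measurable]: "Xid \<in> M \<rightarrow>\<^sub>M borel" "Yid \<in> M \<rightarrow>\<^sub>M N"
    "Xdi \<in> M \<rightarrow>\<^sub>M borel" "Ydi \<in> M \<rightarrow>\<^sub>M N"
    using mod by (auto simp: eSO_model_def indep_var3_def)
  note h[measurable]
  let ?S = "borel \<Otimes>\<^sub>M N" and ?id = "\<lambda>\<omega>. (Xid \<omega>, Yid \<omega>)" and ?di = "\<lambda>\<omega>. (Xdi \<omega>, Ydi \<omega>)"
  define A where "A = {\<omega> \<in> space M. U \<omega> = 0}"
  define B where "B = {\<omega> \<in> space M. U \<omega> \<noteq> 0}"
  have [measurable]: "A \<in> sets M" "B \<in> sets M" unfolding A_def B_def by measurable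
  have obs[measurable]: "eSO_obs U Xid Yid Xdi Ydi \<in> M \<rightarrow>\<^sub>M ?S"
    unfolding eSO_obs_def[abs_def] by measurable
  have A_vim: "A = U -` {0} \<inter> space M" and B_vim: "B = U -` (- {0}) \<inter> space M"
    by (auto simp: A_def B_def)
  have pA: "M.prob A = 1 - s"
  proof -
    have "M.prob A = measure (distr M (count_space UNIV) U) {0}"
      unfolding A_vim by (subst measure_distr) auto
    also have "\<dots> = 1 - s" using mod s by (simp add: eSO_model_def measure_pmf_single)
    finally show ?thesis .
  qed
  have pB: "M.prob B = s"
  proof -
    have "B = space M - A" by (auto simp: A_def B_def)
    then show ?thesis using M.prob_compl[of A] pA by simp
  qed
  \<comment> \<open>Restricting \<open>M\<close> to \<open>U = 0\<close> and to \<open>U \<noteq> 0\<close> gives the two parts of the mixture as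
    image measures. The factor \<open>s\<close> is put on the first marginal, so that agreement on rectangles
    identifies the second part.\<close>
  have id: "distr (density M (indicator A)) ?S ?id = scale_measure (ennreal (1 - s)) Pid"
  proof (rule measure_eqI)
    have PidD: "Pid = distr M ?S ?id" using mod by (simp add: eSO_model_def)
    then show "sets (distr (density M (indicator A)) ?S ?id) = sets (scale_measure (ennreal (1 - s)) Pid)"
      by simp
    fix E assume "E \<in> sets (distr (density M (indicator A)) ?S ?id)"
    then have E[measurable]: "E \<in> sets ?S" by simp
    let ?E = "?id -` E \<inter> space M"
    have E'[measurable]: "?E \<in> sets M" using E by measurable
    have "M.prob (A \<inter> ?E) = M.prob A * M.prob ?E"
    proof (rule M.indep_setD)
      show "M.indep_set {U -` E \<inter> space M | E. E \<in> sets (count_space UNIV)} {?id -` E \<inter> space M | E. E \<in> sets ?S}"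
        using mod by (simp add: eSO_model_def indep_var2_def)
      show "A \<in> {U -` E \<inter> space M | E. E \<in> sets (count_space UNIV)}" unfolding A_vim by auto
      show "?E \<in> {?id -` E \<inter> space M | E. E \<in> sets ?S}" using E by blast
    qed
    then have "emeasure M (A \<inter> ?E) = ennreal (1 - s) * emeasure M ?E"
      using s by (simp add: M.emeasure_eq_measure pA ennreal_mult)
    then show "emeasure (distr (density M (indicator A)) ?S ?id) E = emeasure (scale_measure (ennreal (1 - s)) Pid) E"
      by (simp add: emeasure_distr emeasure_restricted PidD)
  qed
  have di: "distr (density M (indicator B)) ?S ?di = scale_measure (ennreal s) QX \<Otimes>\<^sub>M QY"
  proof (rule pair_measure_eqI[symmetric])
    interpret QY: prob_space QY unfolding QY[symmetric] by (rule M.prob_space_distr) measurable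
    interpret QX: prob_space QX unfolding QX[symmetric] by (rule M.prob_space_distr) measurable
    show "sigma_finite_measure QY" ..
    have "finite_measure (scale_measure (ennreal s) QX)"
      by (rule finite_measureI) (simp add: space_scale_measure QX.emeasure_space_1)
    then show "sigma_finite_measure (scale_measure (ennreal s) QX)" by (simp add: finite_measure_def)
    show "sets (scale_measure (ennreal s) QX \<Otimes>\<^sub>M QY) = sets (distr (density M (indicator B)) ?S ?di)"
      by (simp add: QX[symmetric] QY[symmetric] cong: sets_pair_measure_cong)
    fix E F assume "E \<in> sets (scale_measure (ennreal s) QX)" "F \<in> sets QY"
    then have EF[measurable]: "E \<in> sets borel" "F \<in> sets N" by (auto simp: QX[symmetric] QY[symmetric])
    let ?E = "Xdi -` E \<inter> space M" and ?F = "Ydi -` F \<inter> space M"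
    have E'[measurable]: "?E \<in> sets M" "?F \<in> sets M" using EF by measurable
    have three: "{..<3} = {0, 1, 2::nat}" by auto
    let ?S3 = "\<lambda>i::nat. [B, ?E, ?F] ! i"
    have "M.prob (\<Inter>i\<in>{..<3}. ?S3 i) = (\<Prod>i\<in>{..<3}. M.prob (?S3 i))"
    proof (rule M.indep_setsD)
      show "M.indep_sets (\<lambda>i::nat. [{U -` E \<inter> space M | E. E \<in> sets (count_space UNIV)},
                  {Xdi -` E \<inter> space M | E. E \<in> sets borel},
                  {Ydi -` E \<inter> space M | E. E \<in> sets N}] ! i) {..<3}"
        using mod by (simp add: eSO_model_def indep_var3_def)
      show "\<forall>j\<in>{..<3}. ?S3 j \<in> [{U -` E \<inter> space M | E. E \<in> sets (count_space UNIV)},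
                  {Xdi -` E \<inter> space M | E. E \<in> sets borel},
                  {Ydi -` E \<inter> space M | E. E \<in> sets N}] ! j"
        using EF unfolding three B_vim by (auto simp: numeral_2_eq_2)
    qed (auto simp: three)
    then have "M.prob (B \<inter> (?E \<inter> ?F)) = s * (M.prob ?E * M.prob ?F)"
      by (simp add: three pB numeral_2_eq_2 mult.assoc)
    then have "emeasure M (B \<inter> (?E \<inter> ?F)) = ennreal s * emeasure M ?E * emeasure M ?F"
      using s by (simp add: M.emeasure_eq_measure ennreal_mult mult.assoc)
    moreover have "?di -` (E \<times> F) \<inter> space M = ?E \<inter> ?F" by auto
    moreover have "E \<times> F \<in> sets ?S" by measurable
    ultimately show "emeasure (scale_measure (ennreal s) QX) E * emeasure QY F = emeasure (distr (density M (indicator B)) ?S ?di) (E \<times> F)"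
      by (simp add: emeasure_distr emeasure_restricted QX[symmetric] QY[symmetric])
  qed
  have dd: "(\<integral>\<^sup>+z. h z \<partial>(scale_measure (ennreal s) QX \<Otimes>\<^sub>M QY)) = ennreal s * (\<integral>\<^sup>+z. h z \<partial>(QX \<Otimes>\<^sub>M QY))"
  proof -
    interpret QY: prob_space QY unfolding QY[symmetric] by (rule M.prob_space_distr) measurable
    have [measurable_cong]: "sets QX = sets borel" "sets QY = sets N" by (auto simp: QX[symmetric] QY[symmetric])
    have h': "h \<in> borel_measurable (QX \<Otimes>\<^sub>M QY)" "h \<in> borel_measurable (scale_measure (ennreal s) QX \<Otimes>\<^sub>M QY)" by measurable
    show ?thesis
      unfolding QY.nn_integral_fst[OF h'(1), symmetric] QY.nn_integral_fst[OF h'(2), symmetric]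
      by (rule nn_integral_scale_measure) (use h' in measurable)
  qed
  have "(\<integral>\<^sup>+z. h z \<partial>P) = (\<integral>\<^sup>+\<omega>. indicator A \<omega> * h (?id \<omega>) + indicator B \<omega> * h (?di \<omega>) \<partial>M)"
    unfolding P by (subst nn_integral_distr) (auto intro!: nn_integral_cong simp: eSO_obs_def A_def B_def)
  also have "\<dots> = (\<integral>\<^sup>+\<omega>. indicator A \<omega> * h (?id \<omega>) \<partial>M) + (\<integral>\<^sup>+\<omega>. indicator B \<omega> * h (?di \<omega>) \<partial>M)"
    by (rule nn_integral_add) measurable
  also have "(\<integral>\<^sup>+\<omega>. indicator A \<omega> * h (?id \<omega>) \<partial>M) = (\<integral>\<^sup>+z. h z \<partial>distr (density M (indicator A)) ?S ?id)"
    by (subst nn_integral_distr) (simp_all add: nn_integral_density)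
  also have "(\<integral>\<^sup>+\<omega>. indicator B \<omega> * h (?di \<omega>) \<partial>M) = (\<integral>\<^sup>+z. h z \<partial>distr (density M (indicator B)) ?S ?di)"
    by (subst nn_integral_distr) (simp_all add: nn_integral_density)
  finally show "(\<integral>\<^sup>+z. h z \<partial>P) = ennreal (1 - s) * (\<integral>\<^sup>+z. h z \<partial>Pid) + ennreal s * (\<integral>\<^sup>+z. h z \<partial>(QX \<Otimes>\<^sub>M QY))"
    unfolding id di dd using mod by (subst (asm) nn_integral_scale_measure) (auto simp: eSO_model_def)
qed

lemma distr_pair_snd:
  assumes "prob_space A" "prob_space C"
  shows "distr (A \<Otimes>\<^sub>M C) C snd = C"
proof (rule measure_eqI)
  interpret A: prob_space A by fact
  interpret C: prob_space C by fact
  fix E assume "E \<in> sets (distr (A \<Otimes>\<^sub>M C) C snd)"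
  then have E: "E \<in> sets C" by simp
  then have "snd -` E \<inter> space (A \<Otimes>\<^sub>M C) = space A \<times> E"
    using sets.sets_into_space by (auto simp: space_pair_measure)
  then show "emeasure (distr (A \<Otimes>\<^sub>M C) C snd) E = emeasure C E"
    using E by (simp add: emeasure_distr C.emeasure_pair_measure_Times A.emeasure_space_1)
qed simp

text \<open>The model is realised on the product space, with all of \<open>U\<close>, the ideal pair,
  \<open>X\<^sup>d\<^sup>i\<close> and \<open>Y\<^sup>d\<^sup>i\<close> independent.\<close>

lemma eSO_laws_nonempty:
  fixes QX :: "(real^'n) measure"
  assumes s: "0 \<le> s" "s \<le> 1"
    and id: "prob_space Pid" "sets Pid = sets (borel \<Otimes>\<^sub>M N)"
    and X: "prob_space QX" "sets QX = sets borel" and Y: "prob_space QY" "sets QY = sets N"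
  shows "eSO_laws N Pid s QX QY \<noteq> {}"
proof -
  define B where "B = measure_pmf (binomial_pmf 1 s)"
  have B: "prob_space B" "space B = UNIV" "sets B = sets (count_space UNIV)"
    by (simp_all add: B_def measure_pmf.prob_space_axioms)
  let ?C = "QX \<Otimes>\<^sub>M QY"
  let ?M = "B \<Otimes>\<^sub>M (Pid \<Otimes>\<^sub>M ?C)"
  note [measurable_cong] = B(3) id(2) X(2) Y(2)
  have pC: "prob_space ?C" by (rule prob_space_pair[OF X(1) Y(1)])
  have pI: "prob_space (Pid \<Otimes>\<^sub>M ?C)" by (rule prob_space_pair[OF id(1) pC])
  have pM: "prob_space ?M" by (rule prob_space_pair[OF B(1) pI])
  interpret M: prob_space ?M by fact
  let ?U = "fst" and ?id = "\<lambda>t. fst (snd t)"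
    and ?Xd = "\<lambda>t. fst (snd (snd t))" and ?Yd = "\<lambda>t. snd (snd (snd t))"
  have rect: "M.prob (E \<times> F \<times> H \<times> K) = measure B E * (measure Pid F * (measure QX H * measure QY K))"
    if "E \<in> sets B" "F \<in> sets Pid" "H \<in> sets QX" "K \<in> sets QY" for E F H K
  proof -
    have prod: "measure (A \<Otimes>\<^sub>M C) (E \<times> F) = measure A E * measure C F"
      if "prob_space C" "E \<in> sets A" "F \<in> sets C" for A :: "'x measure" and C :: "'z measure" and E F
    proof -
      interpret C: prob_space C by fact
      show ?thesis using that by (simp add: measure_def C.emeasure_pair_measure_Times enn2real_mult)
    qed
    show ?thesis using that by (simp add: prod pC pI Y)
  qed
  have sp: "space ?M = UNIV \<times> space Pid \<times> space QX \<times> space QY" by (simp add: space_pair_measure B)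
  have top: "space Pid \<in> sets (borel \<Otimes>\<^sub>M N)" "space QX \<in> sets borel" "space QY \<in> sets N"
    using sets.top[of Pid] sets.top[of QX] sets.top[of QY] by (simp_all add: id X Y)
  have one: "measure Pid (space Pid) = 1" "measure QX (space QX) = 1" "measure QY (space QY) = 1" "measure B UNIV = 1"
    using id X Y B by (simp_all add: prob_space.prob_space flip: B(2))
  have ms: "fst \<in> ?M \<rightarrow>\<^sub>M count_space UNIV"
    "?id \<in> ?M \<rightarrow>\<^sub>M borel \<Otimes>\<^sub>M N" "?Xd \<in> ?M \<rightarrow>\<^sub>M borel" "?Yd \<in> ?M \<rightarrow>\<^sub>M N"
    by measurable
  have vU: "fst -` E \<inter> space ?M = E \<times> space Pid \<times> space QX \<times> space QY"
    and vI: "?id -` F \<inter> space ?M = UNIV \<times> (F \<inter> space Pid) \<times> space QX \<times> space QY"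
    and vX: "?Xd -` H \<inter> space ?M = UNIV \<times> space Pid \<times> (H \<inter> space QX) \<times> space QY"
    and vY: "?Yd -` K \<inter> space ?M = UNIV \<times> space Pid \<times> space QX \<times> (K \<inter> space QY)" for E F H K
    unfolding sp by auto
  have ind2: "indep_var2 ?M (count_space UNIV) fst (borel \<Otimes>\<^sub>M N) ?id"
    unfolding indep_var2_def M.indep_sets2_eq
  proof (intro conjI ballI)
    fix a b assume "a \<in> {fst -` E \<inter> space ?M |E. E \<in> sets (count_space UNIV)}"
      "b \<in> {?id -` E \<inter> space ?M |E. E \<in> sets (borel \<Otimes>\<^sub>M N)}"
    then obtain E F where F: "F \<in> sets (borel \<Otimes>\<^sub>M N)" and a: "a = fst -` E \<inter> space ?M" and b: "b = ?id -` F \<inter> space ?M" by auto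
    have ab: "a \<inter> b = E \<times> (F \<inter> space Pid) \<times> space QX \<times> space QY" unfolding a b vU vI by auto
    show "M.prob (a \<inter> b) = M.prob a * M.prob b"
      unfolding ab unfolding a b vU vI using F id by (simp add: rect one B top)
  qed (use ms measurable_sets[OF ms(1)] measurable_sets[OF ms(2)] in auto)
  have ind3: "indep_var3 ?M (count_space UNIV) fst borel ?Xd N ?Yd"
  proof -
    have three: "{..<3} = {0, 1, 2::nat}" by auto
    let ?F = "\<lambda>i::nat. [{fst -` E \<inter> space ?M | E. E \<in> sets (count_space UNIV)},
                  {?Xd -` E \<inter> space ?M | E. E \<in> sets borel},
                  {?Yd -` E \<inter> space ?M | E. E \<in> sets N}] ! i"
    have "M.indep_sets ?F {..<3}"
    proof (subst M.indep_sets_finite)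
      show "\<forall>S\<in>Pi {..<3} ?F. M.prob (\<Inter>j\<in>{..<3}. S j) = (\<Prod>j\<in>{..<3}. M.prob (S j))"
      proof
        fix S assume S: "S \<in> Pi {..<3} ?F"
        have "S 0 \<in> ?F 0" "S 1 \<in> ?F 1" "S 2 \<in> ?F 2" by (rule Pi_mem[OF S], simp)+
        then obtain E H K where HK: "H \<in> sets borel" "K \<in> sets N"
          and S': "S 0 = fst -` E \<inter> space ?M" "S 1 = ?Xd -` H \<inter> space ?M" "S 2 = ?Yd -` K \<inter> space ?M"
          by (auto simp: numeral_2_eq_2)
        have int: "S 0 \<inter> (S 1 \<inter> S 2) = E \<times> space Pid \<times> (H \<inter> space QX) \<times> (K \<inter> space QY)"
          unfolding S' vU vX vY by auto
        have "M.prob (S 0 \<inter> (S 1 \<inter> S 2)) = M.prob (S 0) * (M.prob (S 1) * M.prob (S 2))"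
          unfolding int unfolding S' vU vX vY using HK X Y by (simp add: rect one B top)
        then show "M.prob (\<Inter>j\<in>{..<3}. S j) = (\<Prod>j\<in>{..<3}. M.prob (S j))" by (simp add: three)
      qed
      show "?F i \<subseteq> M.events" if "i \<in> {..<3}" for i
        using that measurable_sets[OF ms(1)] measurable_sets[OF ms(3)] measurable_sets[OF ms(4)]
        unfolding three by (auto simp: numeral_2_eq_2)
      show "space ?M \<in> ?F i" if "i \<in> {..<3}" for i
      proof -
        have full: "space ?M \<in> {Z -` E \<inter> space ?M | E. E \<in> sets A}" if "Z \<in> ?M \<rightarrow>\<^sub>M A" for Z and A :: "'z measure"
        proof -
          have "space ?M = Z -` space A \<inter> space ?M" using measurable_space[OF that] by auto
          then show ?thesis by blast
        qed
        have "i = 0 \<or> i = 1 \<or> i = 2" using that by auto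
        with full[OF ms(1)] full[OF ms(3)] full[OF ms(4)] show ?thesis
          by (elim disjE) (simp_all del: mem_Collect_eq)
      qed
    qed (auto simp: three)
    then show ?thesis using ms by (simp add: indep_var3_def)
  qed
  have distr_fst: "distr (A \<Otimes>\<^sub>M C) A fst = A" if "prob_space C"
    for A :: "'x measure" and C :: "'z measure"
    using that by (rule prob_space.distr_pair_fst)
  have d1: "distr ?M B fst = B" by (rule distr_fst[OF pI])
  have chain: "distr K L (\<lambda>t. g (f t)) = distr (distr K J f) L g"
    if "f \<in> K \<rightarrow>\<^sub>M J" "g \<in> J \<rightarrow>\<^sub>M L" for K :: "'x measure" and J :: "'z measure" and L :: "'v measure" and f g
    using distr_distr[OF that(2,1)] by (simp add: comp_def)
  have d2: "distr ?M Pid ?id = Pid"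
    unfolding chain[OF measurable_snd measurable_fst] distr_pair_snd[OF B(1) pI] distr_fst[OF pC] ..
  have d34: "distr ?M ?C (\<lambda>t. snd (snd t)) = ?C"
    unfolding chain[OF measurable_snd measurable_snd] distr_pair_snd[OF B(1) pI] distr_pair_snd[OF id(1) pC] ..
  have ss: "(\<lambda>t. snd (snd t)) \<in> ?M \<rightarrow>\<^sub>M ?C"
    by (rule measurable_compose[OF measurable_snd measurable_snd])
  have d3: "distr ?M QX ?Xd = QX"
    unfolding chain[OF ss measurable_fst] d34 distr_fst[OF Y(1)] ..
  have d4: "distr ?M QY ?Yd = QY"
    unfolding chain[OF ss measurable_snd] d34 distr_pair_snd[OF X(1) Y(1)] ..
  have cs: "distr ?M A Z = distr ?M A' Z" if "sets A = sets A'" for A A' :: "'z measure" and Z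
    using that by (intro distr_cong) simp_all
  have "distr ?M (borel \<Otimes>\<^sub>M N) ?id = Pid" "distr ?M (count_space UNIV) fst = B"
    using d1 d2 cs[OF id(2)] cs[OF B(3)] by simp_all
  then have model: "eSO_model N Pid s ?M fst (\<lambda>t. fst (?id t)) (\<lambda>t. snd (?id t)) ?Xd ?Yd"
    unfolding eSO_model_def using pM ms ind2 ind3 by (simp add: B_def)
  have "distr ?M borel ?Xd = QX" "distr ?M N ?Yd = QY"
    using d3 d4 cs[OF X(2)] cs[OF Y(2)] by simp_all
  with eSO_laws_any_space[OF model] show ?thesis by auto
qed

lemma eSO_laws_unique:
  fixes QX :: "(real^'n) measure"
  assumes s: "0 \<le> s" "s \<le> 1" and P: "P \<in> eSO_laws N Pid s QX QY" "P' \<in> eSO_laws N Pid s QX QY"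
  shows "P = P'"
proof (rule measure_eqI)
  have dummy: "(\<lambda>_. 0) \<in> borel_measurable (borel \<Otimes>\<^sub>M N)" by simp
  have sets: "sets P = sets (borel \<Otimes>\<^sub>M N)" "sets P' = sets (borel \<Otimes>\<^sub>M N)"
    using eSO_laws_nn_integral(1)[OF _ s dummy] P by blast+
  then show "sets P = sets P'" by simp
  fix A assume A: "A \<in> sets P"
  then have "indicator A \<in> borel_measurable (borel \<Otimes>\<^sub>M N)" using sets by simp
  from eSO_laws_nn_integral(2)[OF P(1) s this] eSO_laws_nn_integral(2)[OF P(2) s this]
  show "emeasure P A = emeasure P' A" using A sets by (metis nn_integral_indicator)
qed

lemma mse_eSO_law:
  fixes QX :: "(real^'n) measure"
  assumes P: "P \<in> eSO_laws N Pid s QX QY" and s: "0 \<le> s" "s \<le> 1"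
    and [measurable]: "f \<in> borel_measurable N"
  shows "mse P f = ennreal (1 - s) * mse Pid f + ennreal s * mse (QX \<Otimes>\<^sub>M QY) f"
  unfolding mse_def by (rule eSO_laws_nn_integral(2)[OF P s]) measurable

section \<open>The least favourable contamination\<close>

lemma sets_least_fav_Y [simp, measurable_cong]: "sets (least_fav_Y r \<rho> D PY) = sets PY"
  by (simp add: least_fav_Y_def)

text \<open>The factor \<open>(1 - r) / r\<close> in the density turns the contamination weight \<open>r\<close> into the
  ideal weight \<open>1 - r\<close>, so that both parts of the risk become integrals over the same law.\<close>

lemma nn_integral_least_fav_Y:
  assumes "0 < r" "r < 1" and [measurable]: "D \<in> borel_measurable PY" "u \<in> borel_measurable PY"
  shows "ennreal r * (\<integral>\<^sup>+y. u y \<partial>least_fav_Y r \<rho> D PY) =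
    ennreal (1 - r) * (\<integral>\<^sup>+y. ennreal (max (norm (D y) / \<rho> - 1) 0) * u y \<partial>PY)"
proof -
  have eq: "ennreal r * (ennreal ((1 - r) / r * max (norm (D y) / \<rho> - 1) 0) * u y) =
      ennreal (1 - r) * (ennreal (max (norm (D y) / \<rho> - 1) 0) * u y)" for y
  proof -
    have "r * ((1 - r) / r * max (norm (D y) / \<rho> - 1) 0) = (1 - r) * max (norm (D y) / \<rho> - 1) 0"
      using assms(1) by simp
    then have "ennreal r * ennreal ((1 - r) / r * max (norm (D y) / \<rho> - 1) 0) =
        ennreal (1 - r) * ennreal (max (norm (D y) / \<rho> - 1) 0)"
      using assms(1,2) by (subst (1 2) ennreal_mult[symmetric]) auto
    then show ?thesis by (simp add: mult.assoc[symmetric])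
  qed
  have "ennreal r * (\<integral>\<^sup>+y. u y \<partial>least_fav_Y r \<rho> D PY) =
      ennreal r * (\<integral>\<^sup>+y. ennreal ((1 - r) / r * max (norm (D y) / \<rho> - 1) 0) * u y \<partial>PY)"
    unfolding least_fav_Y_def by (subst nn_integral_density) measurable
  also have "\<dots> = (\<integral>\<^sup>+y. ennreal (1 - r) * (ennreal (max (norm (D y) / \<rho> - 1) 0) * u y) \<partial>PY)"
    unfolding eq[symmetric] by (rule nn_integral_cmult[symmetric]) measurable
  also have "\<dots> = ennreal (1 - r) * (\<integral>\<^sup>+y. ennreal (max (norm (D y) / \<rho> - 1) 0) * u y \<partial>PY)"
    by (rule nn_integral_cmult) measurable
  finally show ?thesis .
qed

text \<open>The least favourable law lives where \<open>|D| > \<rho>\<close>; there the clipped deviation has exactly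
  the maximal length \<open>\<rho>\<close>.\<close>

lemma least_fav_Y_clipped_sq:
  assumes "0 < \<rho>" and [measurable]: "D \<in> borel_measurable PY"
    and mass: "emeasure (least_fav_Y r \<rho> D PY) (space PY) = 1"
  shows "(\<integral>\<^sup>+y. ennreal ((norm (clip_weight \<rho> (D y) *\<^sub>R D y))\<^sup>2) \<partial>least_fav_Y r \<rho> D PY) = ennreal (\<rho>\<^sup>2)"
proof -
  let ?d = "\<lambda>y. ennreal ((1 - r) / r * max (norm (D y) / \<rho> - 1) 0)"
  have "(\<integral>\<^sup>+y. ennreal ((norm (clip_weight \<rho> (D y) *\<^sub>R D y))\<^sup>2) \<partial>least_fav_Y r \<rho> D PY) =
      (\<integral>\<^sup>+y. ?d y * ennreal ((norm (clip_weight \<rho> (D y) *\<^sub>R D y))\<^sup>2) \<partial>PY)"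
    unfolding least_fav_Y_def by (rule nn_integral_density) measurable
  also have "\<dots> = (\<integral>\<^sup>+y. ?d y * ennreal (\<rho>\<^sup>2) \<partial>PY)"
  proof (rule nn_integral_cong)
    fix y
    show "?d y * ennreal ((norm (clip_weight \<rho> (D y) *\<^sub>R D y))\<^sup>2) = ?d y * ennreal (\<rho>\<^sup>2)"
    proof (cases "\<rho> < norm (D y)")
      case True
      then show ?thesis using norm_clip_eq[OF assms(1)] by metis
    next
      case False
      then have "?d y = 0" using assms(1) by (simp add: max_def field_simps)
      then show ?thesis by simp
    qed
  qed
  also have "\<dots> = (\<integral>\<^sup>+y. ennreal (\<rho>\<^sup>2) \<partial>least_fav_Y r \<rho> D PY)"
    unfolding least_fav_Y_def by (subst nn_integral_density) simp_all
  also have "\<dots> = ennreal (\<rho>\<^sup>2)" using mass by (simp add: least_fav_Y_def)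
  finally show ?thesis .
qed

section \<open>The saddle-point\<close>

theorem theorem3p10:
  fixes M :: "'w measure" and X :: "'w \<Rightarrow> real^'n" and N :: "'y measure" and Y :: "'w \<Rightarrow> 'y"
    and \<mu> :: "'y measure" and p :: "'y \<Rightarrow> real^'n \<Rightarrow> ennreal"
    and Pid :: "((real^'n) \<times> 'y) measure"
    and m D f0 :: "'y \<Rightarrow> real^'n" and a :: "real^'n"
    and r G \<rho> :: real
    and P0X :: "(real^'n) measure" and P0Y :: "'y measure"
  assumes "prob_space M" and "X \<in> M \<rightarrow>\<^sub>M borel" and "Y \<in> M \<rightarrow>\<^sub>M N"
    and "integrable M (\<lambda>\<omega>. (norm (X \<omega>))\<^sup>2)"
    and "has_cond_density M X N Y \<mu> p"
    and Pid: "Pid = distr M (borel \<Otimes>\<^sub>M N) (\<lambda>\<omega>. (X \<omega>, Y \<omega>))"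
    and "0 < (\<integral>\<omega>. (norm (X \<omega>))\<^sup>2 \<partial>M)" and "(\<integral>\<omega>. (norm (X \<omega>))\<^sup>2 \<partial>M) \<le> G"
    and "0 < r" and "r < 1"
    and a: "a = (\<integral>\<omega>. X \<omega> \<partial>M)"
    and "cond_mean_version M X N Y m"
    and D: "D = (\<lambda>y. m y - a)"
    and "0 < \<rho>"
    and f0: "f0 = (\<lambda>y. a + clip_weight \<rho> (D y) *\<^sub>R D y)"
    and P0Y: "P0Y = least_fav_Y r \<rho> D (distr M N Y)"
    and "emeasure P0Y (space N) = 1"
    and "eSO_admissible a G P0X" and "(\<integral>x. (norm x)\<^sup>2 \<partial>P0X) = G"
  shows "\<exists>P0 V. eSO_laws N Pid r P0X P0Y = {P0} \<and>
      eSO_saddle_point N Pid G r f0 P0 \<and>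
      V = trace (cov_matrix M X) + r * (G - (\<integral>\<omega>. (norm (X \<omega>))\<^sup>2 \<partial>M))
            - (1 - r) * (\<integral>\<omega>. (norm (D (Y \<omega>)))\<^sup>2 * clip_weight \<rho> (D (Y \<omega>)) \<partial>M) \<and>
      0 \<le> V \<and> mse P0 f0 = ennreal V \<and> eSO_minimax_risk N Pid G r = ennreal V"
proof -
  interpret M: prob_space M by fact
  note [measurable] = \<open>X \<in> M \<rightarrow>\<^sub>M borel\<close> \<open>Y \<in> M \<rightarrow>\<^sub>M N\<close>
  note X2 = \<open>integrable M (\<lambda>\<omega>. (norm (X \<omega>))\<^sup>2)\<close> and r = \<open>0 < r\<close> \<open>r < 1\<close> and \<rho> = \<open>0 < \<rho>\<close>
  note pyth = M.cond_mean_pythagoras[OF \<open>X \<in> M \<rightarrow>\<^sub>M borel\<close> \<open>Y \<in> M \<rightarrow>\<^sub>M N\<close> X2 \<open>cond_mean_version M X N Y m\<close>]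
  note residual_L2 = M.cond_mean_residual_L2[OF \<open>X \<in> M \<rightarrow>\<^sub>M borel\<close> \<open>Y \<in> M \<rightarrow>\<^sub>M N\<close> X2 \<open>cond_mean_version M X N Y m\<close>]
  note dev = M.second_moment_about_mean[OF \<open>X \<in> M \<rightarrow>\<^sub>M borel\<close> X2 a]
  have [measurable]: "m \<in> borel_measurable N"
    using \<open>cond_mean_version M X N Y m\<close> by (simp add: cond_mean_version_def)
  have D_meas[measurable]: "D \<in> borel_measurable N" unfolding D by measurable
  have f0_meas[measurable]: "f0 \<in> borel_measurable N" unfolding f0 by measurable
  define w where "w = (\<lambda>y. clip_weight \<rho> (D y))"
  define h where "h = (\<lambda>y. max (norm (D y) / \<rho> - 1) 0)"
  have [measurable]: "w \<in> borel_measurable N" "h \<in> borel_measurable N"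
    unfolding w_def h_def by measurable
  have w01: "0 < w y" "w y \<le> 1" for y using clip_weight_eq[OF \<rho>] by (auto simp: w_def)
  have h0: "0 \<le> h y" for y by (simp add: h_def)

  \<comment> \<open>\<open>R\<close> is the ideal Bayes risk; \<open>R + D2\<close> is the total variance (fact \<open>var\<close>).\<close>
  define S where "S = (\<integral>\<omega>. (norm (X \<omega>))\<^sup>2 \<partial>M)"
  define R where "R = (\<integral>\<omega>. (norm (X \<omega> - m (Y \<omega>)))\<^sup>2 \<partial>M)"
  define D2 where "D2 = (\<integral>\<omega>. (norm (D (Y \<omega>)))\<^sup>2 \<partial>M)"
  define W where "W = (\<integral>\<omega>. (norm (D (Y \<omega>)))\<^sup>2 * w (Y \<omega>) \<partial>M)"
  have R0: "0 \<le> R" unfolding R_def by simp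
  have nnR: "(\<integral>\<^sup>+\<omega>. ennreal ((norm (X \<omega> - m (Y \<omega>)))\<^sup>2) \<partial>M) = ennreal R"
    unfolding R_def by (rule nn_integral_eq_integral[OF residual_L2]) simp
  have intD: "integrable M (\<lambda>\<omega>. (norm (D (Y \<omega>)))\<^sup>2)"
  proof (rule integrableI_bounded)
    have "(\<integral>\<^sup>+\<omega>. ennreal ((norm (D (Y \<omega>)))\<^sup>2) \<partial>M) \<le> ennreal (S - (norm a)\<^sup>2)"
      using pyth[of "\<lambda>_. a"] dev(2) by (simp add: D S_def)
    then show "(\<integral>\<^sup>+\<omega>. ennreal (norm ((norm (D (Y \<omega>)))\<^sup>2)) \<partial>M) < \<infinity>"
      by (simp add: le_less_trans)
  qed measurable
  have nnD: "(\<integral>\<^sup>+\<omega>. ennreal ((norm (D (Y \<omega>)))\<^sup>2) \<partial>M) = ennreal D2" and D20: "0 \<le> D2"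
    unfolding D2_def by (simp_all add: nn_integral_eq_integral[OF intD])
  have var: "S - (norm a)\<^sup>2 = R + D2"
  proof -
    have "ennreal (S - (norm a)\<^sup>2) = ennreal R + ennreal D2"
      using pyth[of "\<lambda>_. a"] dev(2) nnR nnD by (simp add: D S_def)
    then show ?thesis using R0 D20 dev(1) by (simp add: S_def flip: ennreal_plus)
  qed
  have intW: "integrable M (\<lambda>\<omega>. (norm (D (Y \<omega>)))\<^sup>2 * w (Y \<omega>))"
    by (rule Bochner_Integration.integrable_bound[OF intD])
      (use w01 in \<open>auto intro!: AE_I2 mult_left_le simp: less_imp_le abs_mult\<close>)
  have WD: "W \<le> D2"
    unfolding W_def D2_def using w01 by (intro integral_mono intW intD) (auto intro!: mult_left_le)
  have SG: "(norm a)\<^sup>2 \<le> S" "S \<le> G" using dev(1) assms(8) by (simp_all add: S_def)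

  have mse_Pid: "mse Pid f = ennreal R + (\<integral>\<^sup>+\<omega>. ennreal ((norm (D (Y \<omega>) - (f (Y \<omega>) - a)))\<^sup>2) \<partial>M)"
    if [measurable]: "f \<in> borel_measurable N" for f
    unfolding mse_def Pid using pyth[OF that] nnR by (subst nn_integral_distr) (simp_all add: D)
  have mean_Pid: "(\<integral>z. fst z \<partial>Pid) = a" unfolding Pid a by (simp add: integral_distr)
  have "prob_space Pid" unfolding Pid by (rule M.prob_space_distr) measurable
  have P0Y_sets: "sets P0Y = sets N" by (simp add: P0Y)
  have "prob_space P0Y"
    using \<open>emeasure P0Y (space N) = 1\<close> sets_eq_imp_space_eq[OF P0Y_sets] by (intro prob_spaceI) simp
  have adm: "prob_space P0X" "sets P0X = sets borel" "integrable P0X (\<lambda>x. (norm x)\<^sup>2)" "(\<integral>x. x \<partial>P0X) = a"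
    using \<open>eSO_admissible a G P0X\<close> by (auto simp: eSO_admissible_def)

  have r01: "0 \<le> r" "r \<le> 1" using r by auto
  obtain P0 where P0: "P0 \<in> eSO_laws N Pid r P0X P0Y"
    using eSO_laws_nonempty[OF r01 \<open>prob_space Pid\<close> _ adm(1,2) \<open>prob_space P0Y\<close> P0Y_sets] Pid by fastforce
  then have laws: "eSO_laws N Pid r P0X P0Y = {P0}" using eSO_laws_unique[OF r01] by blast

  \<comment> \<open>The risk at the least favourable law as one integral over the ideal law, which can be minimised
    pointwise in \<open>f\<close>.\<close>
  have mse_P0: "mse P0 f = ennreal ((1 - r) * R + r * (G - (norm a)\<^sup>2)) +
      ennreal (1 - r) * (\<integral>\<^sup>+\<omega>. ennreal ((norm (D (Y \<omega>) - (f (Y \<omega>) - a)))\<^sup>2 + h (Y \<omega>) * (norm (f (Y \<omega>) - a))\<^sup>2) \<partial>M)"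
    if [measurable]: "f \<in> borel_measurable N" for f
  proof -
    let ?I = "\<integral>\<^sup>+\<omega>. ennreal ((norm (D (Y \<omega>) - (f (Y \<omega>) - a)))\<^sup>2) \<partial>M"
    let ?J = "\<integral>\<^sup>+\<omega>. ennreal (h (Y \<omega>) * (norm (f (Y \<omega>) - a))\<^sup>2) \<partial>M"
    have J: "ennreal r * (\<integral>\<^sup>+y. ennreal ((norm (f y - a))\<^sup>2) \<partial>P0Y) = ennreal (1 - r) * ?J"
      unfolding P0Y h_def
      by (subst nn_integral_least_fav_Y[OF r]) (simp_all add: nn_integral_distr ennreal_mult)
    have "mse P0 f = ennreal (1 - r) * (ennreal R + ?I) +
        (ennreal r * ennreal (G - (norm a)\<^sup>2) + ennreal (1 - r) * ?J)"
      unfolding mse_eSO_law[OF P0 r01 that] mse_Pid[OF that]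
        mse_pair_measure[OF adm \<open>prob_space P0Y\<close> P0Y_sets that] assms(19) distrib_left J ..
    also have "\<dots> = (ennreal (1 - r) * ennreal R + ennreal r * ennreal (G - (norm a)\<^sup>2)) + ennreal (1 - r) * (?I + ?J)"
      by (simp add: distrib_left ac_simps)
    also have "?I + ?J = (\<integral>\<^sup>+\<omega>. ennreal ((norm (D (Y \<omega>) - (f (Y \<omega>) - a)))\<^sup>2 + h (Y \<omega>) * (norm (f (Y \<omega>) - a))\<^sup>2) \<partial>M)"
      using h0 by (subst nn_integral_add[symmetric]) simp_all
    also have "ennreal (1 - r) * ennreal R + ennreal r * ennreal (G - (norm a)\<^sup>2) = ennreal ((1 - r) * R + r * (G - (norm a)\<^sup>2))"
      using r R0 SG by (simp add: ennreal_mult)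
    finally show ?thesis .
  qed

  define V where "V = (1 - r) * R + r * (G - (norm a)\<^sup>2) + (1 - r) * (D2 - W)"
  have V0: "0 \<le> V" unfolding V_def using r R0 SG WD by simp
  have V_eq: "V = trace (cov_matrix M X) + r * (G - S) - (1 - r) * W"
  proof -
    have D2_eq: "D2 = S - (norm a)\<^sup>2 - R" using var by simp
    show ?thesis unfolding V_def dev(3) S_def[symmetric] D2_eq by (simp add: algebra_simps)
  qed
  have f0a: "f0 y - a = w y *\<^sub>R D y" for y by (simp add: f0 w_def)
  have risk_P0: "mse P0 f0 = ennreal V"
  proof -
    have "(\<integral>\<^sup>+\<omega>. ennreal ((norm (D (Y \<omega>) - (f0 (Y \<omega>) - a)))\<^sup>2 + h (Y \<omega>) * (norm (f0 (Y \<omega>) - a))\<^sup>2) \<partial>M)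
        = (\<integral>\<^sup>+\<omega>. ennreal ((norm (D (Y \<omega>)))\<^sup>2 - (norm (D (Y \<omega>)))\<^sup>2 * w (Y \<omega>)) \<partial>M)"
      unfolding f0a unfolding w_def h_def clip_bayes_value[OF \<rho>] by (simp add: right_diff_distrib)
    also have "\<dots> = ennreal (\<integral>\<omega>. (norm (D (Y \<omega>)))\<^sup>2 - (norm (D (Y \<omega>)))\<^sup>2 * w (Y \<omega>) \<partial>M)"
      using w01 by (intro nn_integral_eq_integral Bochner_Integration.integrable_diff intD intW) (auto intro!: mult_left_le)
    also have "(\<integral>\<omega>. (norm (D (Y \<omega>)))\<^sup>2 - (norm (D (Y \<omega>)))\<^sup>2 * w (Y \<omega>) \<partial>M) = D2 - W"
      unfolding D2_def W_def by (rule Bochner_Integration.integral_diff[OF intD intW])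
    finally show ?thesis
      unfolding mse_P0[OF f0_meas] V_def using r R0 SG WD by (simp add: ennreal_mult)
  qed
  have optimal: "mse P0 f0 \<le> mse P0 f" if "f \<in> borel_measurable N" for f
    unfolding mse_P0[OF f0_meas] mse_P0[OF that] f0a unfolding w_def h_def
    by (intro add_left_mono mult_left_mono nn_integral_mono ennreal_leI clip_bayes_optimal[OF \<rho>]) simp

  have "mse Pid f0 \<le> ennreal R + ennreal D2"
    unfolding mse_Pid[OF f0_meas] nnD[symmetric] f0a
  proof (intro add_left_mono nn_integral_mono ennreal_leI power_mono)
    fix \<omega>
    have "D (Y \<omega>) - w (Y \<omega>) *\<^sub>R D (Y \<omega>) = (1 - w (Y \<omega>)) *\<^sub>R D (Y \<omega>)" by (simp add: algebra_simps)
    then show "norm (D (Y \<omega>) - w (Y \<omega>) *\<^sub>R D (Y \<omega>)) \<le> norm (D (Y \<omega>))"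
      using w01[of "Y \<omega>"] by (simp add: mult_left_le_one_le)
  qed simp
  then have "mse Pid f0 \<le> ennreal (R + D2)" using R0 D20 by simp
  then obtain A where A: "mse Pid f0 = ennreal A" "0 \<le> A" "A \<le> R + D2"
    using R0 D20 by (subst (asm) le_ennreal_iff) auto
  \<comment> \<open>\<open>A\<close> is the risk of \<open>f0\<close> under the ideal law. \<open>B\<close> bounds its risk under every admissible
    contamination and is attained by the least favourable one. As \<open>A \<le> B\<close>, more contamination
    is worse.\<close>
  define B where "B = G - (norm a)\<^sup>2 + \<rho>\<^sup>2"
  have AB: "A \<le> B" unfolding B_def using A(3) var SG by (smt (verit) zero_le_power2)
  have B0: "0 \<le> B" using A AB by simp
  have risk_AB: "ennreal V = ennreal ((1 - r) * A + r * B)"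
  proof -
    have mass: "emeasure (least_fav_Y r \<rho> D (distr M N Y)) (space (distr M N Y)) = 1"
      using \<open>emeasure P0Y (space N) = 1\<close> by (simp add: P0Y)
    have "(\<integral>\<^sup>+y. ennreal ((norm (f0 y - a))\<^sup>2) \<partial>P0Y) = ennreal (\<rho>\<^sup>2)"
      unfolding f0a unfolding w_def P0Y by (rule least_fav_Y_clipped_sq[OF \<rho> _ mass]) simp
    then have "mse (P0X \<Otimes>\<^sub>M P0Y) f0 = ennreal B"
      unfolding mse_pair_measure[OF adm \<open>prob_space P0Y\<close> P0Y_sets f0_meas] assms(19) B_def
      using SG by simp
    then show ?thesis
      unfolding risk_P0[symmetric] mse_eSO_law[OF P0 r01 f0_meas] A(1) using r A(2) B0 by (simp add: ennreal_mult)
  qed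
  have minimal: "mse P f0 \<le> mse P0 f0" if nbhd: "P \<in> eSO_nbhd N Pid G r" for P
  proof -
    obtain s QX QY where s: "0 \<le> s" "s \<le> r" and QX: "eSO_admissible a G QX"
      and QY: "prob_space QY" "sets QY = sets N" and P: "P \<in> eSO_laws N Pid s QX QY"
      using nbhd unfolding eSO_nbhd_def eSO_boundary_def mean_Pid by auto
    interpret QY: prob_space QY by fact
    have QX': "prob_space QX" "sets QX = sets borel" "integrable QX (\<lambda>x. (norm x)\<^sup>2)" "(\<integral>x. x \<partial>QX) = a"
      and QXG: "(\<integral>x. (norm x)\<^sup>2 \<partial>QX) \<le> G"
      using QX by (auto simp: eSO_admissible_def)
    have "(\<integral>\<^sup>+y. ennreal ((norm (f0 y - a))\<^sup>2) \<partial>QY) \<le> (\<integral>\<^sup>+y. ennreal (\<rho>\<^sup>2) \<partial>QY)"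
      unfolding f0a unfolding w_def
      by (intro nn_integral_mono ennreal_leI power_mono norm_clip_le[OF \<rho>]) simp
    also have "\<dots> = ennreal (\<rho>\<^sup>2)" by (simp add: QY.emeasure_space_1)
    finally have "mse (QX \<Otimes>\<^sub>M QY) f0 \<le> ennreal (G - (norm a)\<^sup>2) + ennreal (\<rho>\<^sup>2)"
      unfolding mse_pair_measure[OF QX' QY f0_meas] using QXG by (intro add_mono ennreal_leI) auto
    also have "\<dots> = ennreal B" unfolding B_def using SG by simp
    finally have di: "mse (QX \<Otimes>\<^sub>M QY) f0 \<le> ennreal B" .
    have s1: "s \<le> 1" using s r by simp
    have "mse P f0 \<le> ennreal (1 - s) * ennreal A + ennreal s * ennreal B"
      unfolding mse_eSO_law[OF P s(1) s1 f0_meas] A(1) by (intro add_left_mono mult_left_mono di) simp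
    also have "\<dots> = ennreal ((1 - s) * A + s * B)" using s s1 A(2) B0 by (simp add: ennreal_mult)
    also have "\<dots> \<le> ennreal ((1 - r) * A + r * B)"
    proof (rule ennreal_leI)
      have "0 \<le> (r - s) * (B - A)" using s AB by simp
      then show "(1 - s) * A + s * B \<le> (1 - r) * A + r * B" by (simp add: algebra_simps)
    qed
    finally show ?thesis unfolding risk_P0 risk_AB .
  qed

  have P0_boundary: "P0 \<in> eSO_boundary N Pid G r"
    unfolding eSO_boundary_def mean_Pid
    using P0 \<open>eSO_admissible a G P0X\<close> \<open>prob_space P0Y\<close> P0Y_sets by blast
  then have P0_nbhd: "P0 \<in> eSO_nbhd N Pid G r" unfolding eSO_nbhd_def using r by auto
  have saddle: "eSO_saddle_point N Pid G r f0 P0"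
    unfolding eSO_saddle_point_def using P0_boundary minimal optimal by simp
  have "eSO_minimax_risk N Pid G r = mse P0 f0"
    unfolding eSO_minimax_risk_def
  proof (rule antisym)
    show "(INF f\<in>borel_measurable N. SUP P\<in>eSO_nbhd N Pid G r. mse P f) \<le> mse P0 f0"
      using minimal by (intro INF_lower2[OF f0_meas] SUP_least)
    show "mse P0 f0 \<le> (INF f\<in>borel_measurable N. SUP P\<in>eSO_nbhd N Pid G r. mse P f)"
      using optimal by (intro INF_greatest SUP_upper2[OF P0_nbhd])
  qed
  then show ?thesis
    using laws saddle V_eq V0 risk_P0 unfolding S_def W_def w_def by metis
qed

end
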